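(* Suppose the DAE $\dot y=f(y,z,t)$, $0=g(y,z,t)$ is either semi-explicit index-1 or Hessenberg index-2, with true solution $[y,z]^T$, and let $[Y,Z]^T$ be its numerical solution. Let $\dot y=f(y,z,t)$, $\dot z=h(y,z,t)$ be the corresponding index-reduced ODE. Let $\zeta^y\in\mathbb{R}^n$, $\zeta^z\in\mathbb{R}^m$, and let $(\nu^{(y)},\nu^{(z)})$ solve the adjoint ODE problem with $\psi^y(t)=0$, $\psi^z(t)=0$, i.e. $$-\dot{\nu}^{(y)}=\bar f_y^T\nu^{(y)}+\bar h_y^T\nu^{(z)},\qquad -\dot{\nu}^{(z)}=\bar f_z^T\nu^{(y)}+\bar h_z^T\nu^{(z)},\qquad t\in[0,T),$$ with initial condition $\nu^{(y)}(T)=\zeta^y$, $\nu^{(z)}(T)=\zeta^z$. Then the error $e^{\mathcal{Q}_T}=(e^{(y)}(T),\zeta^y)+(e^{(z)}(T),\zeta^z)$ in the computed quantity of interest $\mathcal{Q}_T(Y,Z)$ is given by $$e^{\mathcal{Q}_T}=\big(\nu^{(y)}(0),e^{(y)}(0)\big)+\big(\nu^{(z)}(0),e^{(z)}(0)\big)+\langle\nu^{(y)},f(Y,Z)-\dot Y\rangle+\langle\nu^{(z)},h(Y,Z)-\dot Z\rangle.$$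
   Context: Setting: $y(t)\in\mathbb{R}^n$, $z(t)\in\mathbb{R}^m$, $t\in[0,T]$; $f$ takes values in $\mathbb{R}^n$, $g$ in $\mathbb{R}^m$, both smooth enough that all derivatives that appear exist and are continuous; subscripts denote partial derivatives (Jacobians). The DAE is index-1 if $g_z$ is invertible in a neighborhood of the solution, and Hessenberg index-2 if $g=g(y,t)$ does not depend on $z$ and $g_yf_z\in\mathbb{R}^{m\times m}$ is invertible in a neighborhood of the solution. Explicit dependence on $t$ is suppressed: $f(Y,Z)$ means $f(Y(t),Z(t),t)$, etc. The function $h$ is obtained by differentiating the constraint and solving for $\dot z$: $$h=\begin{cases}-[g_z]^{-1}[g_yf+g_t], & \text{if the DAE is index-1},\\ -(g_yf_z)^{-1}\left(f^Tg_{yy}f+g_yf_yf+2g_{yt}f+g_yf_t+g_{tt}\right), & \text{if the DAE is index-2},\end{cases}$$ where $(f^Tg_{yy}f)_i=\sum_{j,k=1}^n\frac{\partial^2g_i}{\partial y_j\partial y_k}f_jf_k$, $i=1,\dots,m$. The true solution $[y,z]^T$ of the DAE also solves $\dot y=f$, $\dot z=h$. Numerical solution: with $t_k=k\Delta t$, $\Delta t=T/N$, $Y_0=y(0)$, $Z_0=z(0)$, the values satisfy the BDF-1 (implicit Euler) equations for the DAE, $Y_{k+1}=Y_k+\Delta t\,f(Y_{k+1},Z_{k+1},t_{k+1})$, $0=g(Y_{k+1},Z_{k+1},t_{k+1})$ (with $g(Y_{k+1},t_{k+1})$ in the index-2 case), $k=0,\dots,N-1$. $Y(t),Z(t)$ are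 the continuous piecewise linear interpolants of these values. Their time derivatives are taken piecewise. $e^{(y)}=y-Y$, $e^{(z)}=z-Z$. The numerical solution is assumed close enough to the true one that $h$ and its Jacobians are defined and continuous along the segments joining $(Y(t),Z(t))$ and $(y(t),z(t))$. $(\cdot,\cdot)$ is the Euclidean inner product and $\langle a,b\rangle=\int_0^T(a(t),b(t))\,dt$. $\mathcal{Q}_T(y,z)=(y(T),\zeta^y)+(z(T),\zeta^z)$ and $e^{\mathcal{Q}_T}=\mathcal{Q}_T(y,z)-\mathcal{Q}_T(Y,Z)$. Linearized operators (functions of $t$): $\bar f_y=\int_0^1\frac{\partial f}{\partial y}(\tilde y,\tilde z,t)ds$, $\bar f_z=\int_0^1\frac{\partial f}{\partial z}(\tilde y,\tilde z,t)ds$, $\bar h_y=\int_0^1\frac{\partial h}{\partial y}(\tilde y,\tilde z,t)ds$, $\bar h_z=\int_0^1\frac{\partial h}{\partial z}(\tilde y,\tilde z,t)ds$, with $\tilde y=sy+(1-s)Y$, $\tilde z=sz+(1-s)Z$. The adjoint variables $\nu^{(y)}(t)\in\mathbb{R}^n$, $\nu^{(z)}(t)\in\mathbb{R}^m$ are continuous on $[0,T]$ (absolutely continuous, equations holding for almost every $t$). *)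

theory Defs
  imports "HOL-Analysis.Analysis"
begin

section \<open>Partial derivatives of functions of \<open>(y, z, t)\<close>\<close>

text \<open>
  Functions of \<open>(y, z, t)\<close> are curried. The time variable ranges over \<open>{0..T}\<close>, so time derivatives
  are taken within \<open>{0..T}\<close>; they are one-sided at the two endpoints.
\<close>

definition jac_y :: "(real^'n \<Rightarrow> real^'m \<Rightarrow> real \<Rightarrow> real^'k) \<Rightarrow> real^'n \<Rightarrow> real^'m \<Rightarrow> real \<Rightarrow> real^'n^'k"
  where "jac_y F y z t = jacobian (\<lambda>u. F u z t) (at y)"

definition jac_z :: "(real^'n \<Rightarrow> real^'m \<Rightarrow> real \<Rightarrow> real^'k) \<Rightarrow> real^'n \<Rightarrow> real^'m \<Rightarrow> real \<Rightarrow> real^'m^'k"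
  where "jac_z F y z t = jacobian (\<lambda>v. F y v t) (at z)"

definition der_t :: "real \<Rightarrow> (real^'n \<Rightarrow> real^'m \<Rightarrow> real \<Rightarrow> real^'k) \<Rightarrow> real^'n \<Rightarrow> real^'m \<Rightarrow> real \<Rightarrow> real^'k"
  where "der_t T F y z t = vector_derivative (\<lambda>\<tau>. F y z \<tau>) (at t within {0..T})"

definition grad_y :: "(real^'n \<Rightarrow> real^'m \<Rightarrow> real \<Rightarrow> real^'k) \<Rightarrow> 'k \<Rightarrow> real^'n \<Rightarrow> real^'m \<Rightarrow> real \<Rightarrow> real^'n"
  where "grad_y F i y z t = jac_y F y z t $ i"

definition C1_in_yz :: "((real^'n) \<times> (real^'m) \<times> real) set \<Rightarrow> (real^'n \<Rightarrow> real^'m \<Rightarrow> real \<Rightarrow> real^'k) \<Rightarrow> bool"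
  where "C1_in_yz U F \<longleftrightarrow>
    continuous_on U (\<lambda>(y, z, t). F y z t) \<and>
    (\<forall>(y, z, t) \<in> U. (\<lambda>u. F u z t) differentiable (at y) \<and> (\<lambda>v. F y v t) differentiable (at z)) \<and>
    continuous_on U (\<lambda>(y, z, t). jac_y F y z t) \<and>
    continuous_on U (\<lambda>(y, z, t). jac_z F y z t)"

definition C1_in_yzt :: "real \<Rightarrow> ((real^'n) \<times> (real^'m) \<times> real) set \<Rightarrow> (real^'n \<Rightarrow> real^'m \<Rightarrow> real \<Rightarrow> real^'k) \<Rightarrow> bool"
  where "C1_in_yzt T U F \<longleftrightarrow>
    C1_in_yz U F \<and>
    (\<forall>(y, z, t) \<in> U. (\<lambda>\<tau>. F y z \<tau>) differentiable (at t within {0..T})) \<and>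
    continuous_on U (\<lambda>(y, z, t). der_t T F y z t)"


section \<open>The DAE and its index reduction\<close>

datatype dae_index = Semi_Explicit_Index1 | Hessenberg_Index2

fun has_index ::
  "dae_index \<Rightarrow> ((real^'n) \<times> (real^'m) \<times> real) set \<Rightarrow>
   (real^'n \<Rightarrow> real^'m \<Rightarrow> real \<Rightarrow> real^'n) \<Rightarrow> (real^'n \<Rightarrow> real^'m \<Rightarrow> real \<Rightarrow> real^'m) \<Rightarrow> bool"
  where
    "has_index Semi_Explicit_Index1 U f g \<longleftrightarrow>
       (\<forall>(y, z, t) \<in> U. invertible (jac_z g y z t))"
  | "has_index Hessenberg_Index2 U f g \<longleftrightarrow>
       (\<forall>y z z' t. (y, z, t) \<in> U \<and> (y, z', t) \<in> U \<longrightarrow> g y z t = g y z' t) \<and>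
       (\<forall>(y, z, t) \<in> U. invertible (jac_y g y z t ** jac_z f y z t))"

text \<open>
  The derivatives of \<open>f\<close> and \<open>g\<close> that occur in the definition of \<open>h\<close> and in the linearized operators
  exist and are continuous. In the index-2 case \<open>g\<close> is required to have continuous partial
  derivatives of second order.
\<close>

fun smooth_data ::
  "dae_index \<Rightarrow> real \<Rightarrow> ((real^'n) \<times> (real^'m) \<times> real) set \<Rightarrow>
   (real^'n \<Rightarrow> real^'m \<Rightarrow> real \<Rightarrow> real^'n) \<Rightarrow> (real^'n \<Rightarrow> real^'m \<Rightarrow> real \<Rightarrow> real^'m) \<Rightarrow> bool"
  where
    "smooth_data Semi_Explicit_Index1 T U f g \<longleftrightarrow> C1_in_yzt T U f \<and> C1_in_yzt T U g"
  | "smooth_data Hessenberg_Index2 T U f g \<longleftrightarrow>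
       C1_in_yzt T U f \<and> C1_in_yzt T U g \<and>
       (\<forall>i. C1_in_yzt T U (grad_y g i)) \<and> C1_in_yzt T U (der_t T g)"

text \<open>
  \<open>jac_y (grad_y g i) y z t $ k $ j\<close> is the second partial derivative of \<open>g\<^sub>i\<close> with respect to
  \<open>y\<^sub>j\<close> and \<open>y\<^sub>k\<close>.
\<close>

definition g_yy_quadratic ::
  "(real^'n \<Rightarrow> real^'m \<Rightarrow> real \<Rightarrow> real^'n) \<Rightarrow> (real^'n \<Rightarrow> real^'m \<Rightarrow> real \<Rightarrow> real^'m) \<Rightarrow>
   real^'n \<Rightarrow> real^'m \<Rightarrow> real \<Rightarrow> real^'m"
  where "g_yy_quadratic f g y z t =
    (\<chi> i. \<Sum>j\<in>UNIV. \<Sum>k\<in>UNIV. jac_y (grad_y g i) y z t $ k $ j * f y z t $ j * f y z t $ k)"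

definition g_yt_matrix ::
  "real \<Rightarrow> (real^'n \<Rightarrow> real^'m \<Rightarrow> real \<Rightarrow> real^'m) \<Rightarrow> real^'n \<Rightarrow> real^'m \<Rightarrow> real \<Rightarrow> real^'n^'m"
  where "g_yt_matrix T g y z t = (\<chi> i. der_t T (grad_y g i) y z t)"

text \<open>
  Index 1: \<open>g(y(t), z(t), t) = 0\<close> is differentiated once and solved for \<open>z'\<close>. Index 2:
  \<open>g(y(t), t) = 0\<close> is differentiated twice, using symmetry of the second derivatives of \<open>g\<close>.
\<close>

fun reduced_rhs ::
  "dae_index \<Rightarrow> real \<Rightarrow>
   (real^'n \<Rightarrow> real^'m \<Rightarrow> real \<Rightarrow> real^'n) \<Rightarrow> (real^'n \<Rightarrow> real^'m \<Rightarrow> real \<Rightarrow> real^'m) \<Rightarrow>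
   real^'n \<Rightarrow> real^'m \<Rightarrow> real \<Rightarrow> real^'m"
  where
    "reduced_rhs Semi_Explicit_Index1 T f g y z t =
       - (matrix_inv (jac_z g y z t) *v (jac_y g y z t *v f y z t + der_t T g y z t))"
  | "reduced_rhs Hessenberg_Index2 T f g y z t =
       - (matrix_inv (jac_y g y z t ** jac_z f y z t) *v
           (g_yy_quadratic f g y z t
            + jac_y g y z t *v (jac_y f y z t *v f y z t)
            + 2 *\<^sub>R (g_yt_matrix T g y z t *v f y z t)
            + jac_y g y z t *v der_t T f y z t
            + der_t T (der_t T g) y z t))"

definition dae_solution ::
  "real \<Rightarrow> (real^'n \<Rightarrow> real^'m \<Rightarrow> real \<Rightarrow> real^'n) \<Rightarrow> (real^'n \<Rightarrow> real^'m \<Rightarrow> real \<Rightarrow> real^'m) \<Rightarrow>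
   (real \<Rightarrow> real^'n) \<Rightarrow> (real \<Rightarrow> real^'m) \<Rightarrow> bool"
  where "dae_solution T f g y z \<longleftrightarrow>
    (\<forall>t\<in>{0..T}.
       (y has_vector_derivative f (y t) (z t) t) (at t within {0..T}) \<and>
       z differentiable (at t within {0..T}) \<and>
       g (y t) (z t) t = 0)"


section \<open>The numerical solution\<close>

definition bdf1_solution ::
  "real \<Rightarrow> nat \<Rightarrow> (real^'n \<Rightarrow> real^'m \<Rightarrow> real \<Rightarrow> real^'n) \<Rightarrow> (real^'n \<Rightarrow> real^'m \<Rightarrow> real \<Rightarrow> real^'m) \<Rightarrow>
   real^'n \<Rightarrow> real^'m \<Rightarrow> (nat \<Rightarrow> real^'n) \<Rightarrow> (nat \<Rightarrow> real^'m) \<Rightarrow> bool"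
  where "bdf1_solution T N f g y\<^sub>0 z\<^sub>0 Yk Zk \<longleftrightarrow>
    (let \<Delta>t = T / real N in
       Yk 0 = y\<^sub>0 \<and> Zk 0 = z\<^sub>0 \<and>
       (\<forall>k<N. Yk (Suc k) = Yk k + \<Delta>t *\<^sub>R f (Yk (Suc k)) (Zk (Suc k)) (real (Suc k) * \<Delta>t) \<and>
              0 = g (Yk (Suc k)) (Zk (Suc k)) (real (Suc k) * \<Delta>t)))"

text \<open>
  The piecewise linear interpolant of the values \<open>a k\<close> at the nodes \<open>k \<Delta>t\<close>. At the last node \<open>N \<Delta>t\<close>
  the value \<open>a (N + 1)\<close> is multiplied by zero. The derivative of the interpolant is the slope of the
  current piece, except at the nodes, where it need not exist.
\<close>

definition pw_linear :: "real \<Rightarrow> (nat \<Rightarrow> 'a::real_vector) \<Rightarrow> real \<Rightarrow> 'a"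
  where "pw_linear \<Delta>t a t =
    (let k = nat \<lfloor>t / \<Delta>t\<rfloor> in a k + (t / \<Delta>t - real k) *\<^sub>R (a (Suc k) - a k))"


section \<open>Linearized operators and the adjoint problem\<close>

definition segment_average ::
  "(real^'n \<Rightarrow> real^'m \<Rightarrow> real \<Rightarrow> 'b::euclidean_space) \<Rightarrow>
   (real \<Rightarrow> real^'n) \<Rightarrow> (real \<Rightarrow> real^'m) \<Rightarrow> (real \<Rightarrow> real^'n) \<Rightarrow> (real \<Rightarrow> real^'m) \<Rightarrow> real \<Rightarrow> 'b"
  where "segment_average J y z Y Z t =
    integral {0..1} (\<lambda>s. J (s *\<^sub>R y t + (1 - s) *\<^sub>R Y t) (s *\<^sub>R z t + (1 - s) *\<^sub>R Z t) t)"

text \<open>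
  Absolute continuity of a function on \<open>{a..b}\<close>. A pair \<open>(c, d)\<close> in \<open>D\<close> stands for the interval from
  \<open>c\<close> to \<open>d\<close>; the intervals may only meet at endpoints.
\<close>

definition absolutely_continuous_fun :: "real \<Rightarrow> real \<Rightarrow> (real \<Rightarrow> 'a::real_normed_vector) \<Rightarrow> bool"
  where "absolutely_continuous_fun a b F \<longleftrightarrow>
    (\<forall>\<epsilon>>0. \<exists>\<delta>>0. \<forall>D :: (real \<times> real) set.
       finite D \<and> (\<forall>(c, d) \<in> D. a \<le> c \<and> c \<le> d \<and> d \<le> b) \<and>
       disjoint_family_on (\<lambda>(c, d). {c<..<d}) D \<and> (\<Sum>(c, d)\<in>D. d - c) < \<delta>
       \<longrightarrow> (\<Sum>(c, d)\<in>D. norm (F d - F c)) < \<epsilon>)"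

definition adjoint_solution ::
  "real \<Rightarrow> (real \<Rightarrow> real^'n^'n) \<Rightarrow> (real \<Rightarrow> real^'m^'n) \<Rightarrow> (real \<Rightarrow> real^'n^'m) \<Rightarrow> (real \<Rightarrow> real^'m^'m) \<Rightarrow>
   real^'n \<Rightarrow> real^'m \<Rightarrow> (real \<Rightarrow> real^'n) \<Rightarrow> (real \<Rightarrow> real^'m) \<Rightarrow> bool"
  where "adjoint_solution T fy fz hy hz \<zeta>y \<zeta>z \<nu>y \<nu>z \<longleftrightarrow>
    absolutely_continuous_fun 0 T \<nu>y \<and> absolutely_continuous_fun 0 T \<nu>z \<and>
    (AE t in lebesgue. t \<in> {0..<T} \<longrightarrow>
       (\<nu>y has_vector_derivative - (transpose (fy t) *v \<nu>y t + transpose (hy t) *v \<nu>z t)) (at t) \<and>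
       (\<nu>z has_vector_derivative - (transpose (fz t) *v \<nu>y t + transpose (hz t) *v \<nu>z t)) (at t)) \<and>
    \<nu>y T = \<zeta>y \<and> \<nu>z T = \<zeta>z"


section \<open>The quantity of interest\<close>

definition inner_int :: "real \<Rightarrow> (real \<Rightarrow> 'a::real_inner) \<Rightarrow> (real \<Rightarrow> 'a) \<Rightarrow> real"
  where "inner_int T a b = integral {0..T} (\<lambda>t. a t \<bullet> b t)"

definition final_qoi ::
  "real \<Rightarrow> 'a::real_inner \<Rightarrow> 'b::real_inner \<Rightarrow> (real \<Rightarrow> 'a) \<Rightarrow> (real \<Rightarrow> 'b) \<Rightarrow> real"
  where "final_qoi T \<zeta>y \<zeta>z y z = y T \<bullet> \<zeta>y + z T \<bullet> \<zeta>z"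

end

theory Submission
  imports Defs
begin

text \<open>
  Write \<open>e = (y - Y, z - Z)\<close>. The error formula is the duality between the linearized error equation
  and the adjoint equation. The true solution satisfies \<open>y' = f\<close> and, after index reduction,
  \<open>z' = h\<close>. Splitting \<open>f(y, z) - Y' = (f(y, z) - f(Y, Z)) + (f(Y, Z) - Y')\<close>, and likewise for \<open>h\<close>, and
  integrating along the segment from \<open>(Y, Z)\<close> to \<open>(y, z)\<close> (\<open>segment_average_mean_value\<close>) gives
  \<open>e' = A e + r\<close>, where \<open>A\<close> consists of the averaged Jacobians and \<open>r\<close> is the residual of the numerical
  solution in the reduced ODE. The adjoint solution satisfies \<open>\<nu>' = - A\<^sup>T \<nu>\<close> almost everywhere, so the
  terms with \<open>A\<close> cancel in \<open>(\<nu> \<bullet> e)' = \<nu> \<bullet> r\<close>, and integration over \<open>[0, T]\<close> yields the formula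
  (\<open>adjoint_error_representation\<close>).

  Two points need work. The first is the integration: \<open>\<nu>\<close> is only absolutely continuous and its
  equation holds only almost everywhere. The fundamental theorem of calculus is therefore proved for
  absolutely continuous functions with a derivative off a null set
  (\<open>absolutely_continuous_fun_has_integral\<close>). It applies because \<open>e\<close> is Lipschitz: \<open>y' = f\<close> and \<open>z' = h\<close>
  have continuous right-hand sides, and \<open>Y\<close> and \<open>Z\<close> are piecewise linear.

  The second is \<open>z' = h\<close> (\<open>dae_solution_solves_reduced_ode\<close>). In index 1 it is the chain rule for
  \<open>g(y(t), z(t), t) = 0\<close>, solved for \<open>z'\<close>. In index 2 the first derivative of the constraint is
  \<open>g\<^sub>y f + g\<^sub>t = 0\<close>, which no longer contains \<open>z'\<close> because \<open>g\<^sub>z = 0\<close>; a second differentiation produces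
  \<open>g\<^sub>y f\<^sub>z z'\<close> and the remaining terms of \<open>h\<close> (\<open>hidden_constraint\<close>), where the two mixed terms
  \<open>(g\<^sub>y)\<^sub>t f\<close> and \<open>(g\<^sub>t)\<^sub>y f\<close> are equal by the symmetry of second derivatives.
\<close>

section \<open>Absolutely continuous functions\<close>

text \<open>
  The intervals of a tagged partial division that lie in \<open>V\<close> do not overlap, so their total length is at
  most the measure of \<open>V\<close>. Choosing \<open>V\<close> as an outer open set of \<open>N\<close> with measure below the \<open>\<delta>\<close> of absolute
  continuity bounds the total increment of \<open>F\<close>. This controls the tags at which a gauge argument has no
  derivative available.
\<close>
lemma absolutely_continuous_fun_small_on_tags:
  fixes F :: "real \<Rightarrow> 'a::real_normed_vector"
  assumes ac: "absolutely_continuous_fun a b F" and "negligible N" and "e > 0"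
  obtains V where "open V" "N \<subseteq> V"
    "\<And>q. q tagged_partial_division_of {a..b} \<Longrightarrow> (\<And>x K. (x, K) \<in> q \<Longrightarrow> K \<subseteq> V) \<Longrightarrow>
       (\<Sum>(x, K)\<in>q. norm (F (Sup K) - F (Inf K))) < e"
proof -
  obtain \<delta> where "\<delta> > 0" and \<delta>: "\<And>D :: (real \<times> real) set.
       finite D \<Longrightarrow> (\<forall>(c, d) \<in> D. a \<le> c \<and> c \<le> d \<and> d \<le> b) \<Longrightarrow>
       disjoint_family_on (\<lambda>(c, d). {c<..<d}) D \<Longrightarrow> (\<Sum>(c, d)\<in>D. d - c) < \<delta>
       \<Longrightarrow> (\<Sum>(c, d)\<in>D. norm (F d - F c)) < e"
    using ac \<open>e > 0\<close> unfolding absolutely_continuous_fun_def by meson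
  have N: "N \<in> sets lebesgue" "emeasure lebesgue N = 0"
    using \<open>negligible N\<close> by (auto simp: negligible_iff_null_sets null_sets_def)
  obtain V where V: "open V" "N \<subseteq> V" "V - N \<in> lmeasurable" "emeasure lebesgue (V - N) < ennreal \<delta>"
    using sets_lebesgue_outer_open[OF N(1) \<open>\<delta> > 0\<close>] by blast
  have "V = (V - N) \<union> N"
    using V by auto
  moreover have "emeasure lebesgue ((V - N) \<union> N) = emeasure lebesgue (V - N)"
    using N V by (intro emeasure_Un_null_set) (auto simp: null_sets_def)
  ultimately have emV: "emeasure lebesgue V < ennreal \<delta>"
    using V(4) by simp
  have Vl: "V \<in> lmeasurable"
  proof (rule fmeasurableI)
    show "V \<in> sets lebesgue"
      using V(1) by simp
    show "emeasure lebesgue V < \<infinity>"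
      using emV order_less_trans by fastforce
  qed
  have mV: "measure lebesgue V < \<delta>"
    using emV \<open>\<delta> > 0\<close> Vl by (simp add: emeasure_eq_measure2 ennreal_less_iff)
  show thesis
  proof (rule that[OF V(1,2)])
    fix q assume q: "q tagged_partial_division_of {a..b}"
      and qV: "\<And>x K. (x, K) \<in> q \<Longrightarrow> K \<subseteq> V"
    note qD = tagged_partial_division_ofD[OF q]
    \<comment> \<open>Degenerate intervals contribute nothing and are discarded, so that each remaining interval carries a single tag.\<close>
    define r where "r = {(x, K) \<in> q. Inf K < Sup K}"
    define \<phi> :: "real \<times> real set \<Rightarrow> real \<times> real" where "\<phi> = (\<lambda>(x, K). (Inf K, Sup K))"
    have rq: "r \<subseteq> q"
      by (auto simp: r_def)
    have fr: "finite r"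
      using qD(1) rq finite_subset by blast
    have shape: "K = {Inf K..Sup K} \<and> Inf K \<le> Sup K \<and> a \<le> Inf K \<and> Sup K \<le> b \<and> measure lborel K = Sup K - Inf K"
      if xK: "(x, K) \<in> q" for x K
    proof -
      obtain u v where K: "K = {u..v}"
        using qD(4)[OF xK] by auto
      moreover have "x \<in> K"
        using qD(2)[OF that] .
      ultimately show ?thesis
        using qD(3)[OF that] by auto
    qed
    have disj: "{Inf K<..<Sup K} \<inter> {Inf K'<..<Sup K'} = {}"
      if "(x, K) \<in> r" "(x', K') \<in> r" "(x, K) \<noteq> (x', K')" for x K x' K'
    proof -
      have "interior K \<inter> interior K' = {}"
        using qD(5) that rq by blast
      then show ?thesis
        using shape[of x K] shape[of x' K'] that rq
        by (metis interior_atLeastAtMost_real subsetD)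
    qed
    have inj: "inj_on \<phi> r"
    proof (rule inj_onI, rule ccontr)
      fix s s' assume s: "s \<in> r" "s' \<in> r" "\<phi> s = \<phi> s'" "s \<noteq> s'"
      obtain x K x' K' where ss: "s = (x, K)" "s' = (x', K')"
        by force
      then have "{Inf K<..<Sup K} = {}"
        using disj[of x K x' K'] s by (auto simp: \<phi>_def)
      moreover have "Inf K < Sup K"
        using s ss by (auto simp: r_def)
      ultimately show False
        by (simp add: greaterThanLessThan_empty_iff)
    qed
    have rdiv: "snd ` r division_of \<Union> (snd ` r)"
      by (rule division_of_tagged_division[OF tagged_partial_division_of_Union_self[OF
            tagged_partial_division_subset[OF q rq]]])
    have "\<phi> = (\<lambda>K. (Inf K, Sup K)) \<circ> snd"
      by (auto simp: \<phi>_def)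
    then have "inj_on snd r"
      using inj inj_on_imageI2 by metis
    have rV: "\<Union> (snd ` r) \<subseteq> V"
      using qV rq by fastforce
    have "(\<Sum>(c, d)\<in>\<phi> ` r. d - c) = (\<Sum>(x, K)\<in>r. measure lborel K)"
      unfolding sum.reindex[OF inj] using shape rq
      by (intro sum.cong) (auto simp: \<phi>_def)
    also have "\<dots> = (\<Sum>K\<in>snd ` r. measure lborel K)"
      using sum.reindex[OF \<open>inj_on snd r\<close>, of "measure lborel"] by (simp add: case_prod_unfold)
    also have "\<dots> = (\<Sum>K\<in>snd ` r. measure lebesgue K)"
      using shape rq by (intro sum.cong refl) (metis atLeastAtMost_borel imageE measure_completion prod.collapse sets_lborel subsetD)
    also have "\<dots> = measure lebesgue (\<Union> (snd ` r))"
      by (rule content_division[OF rdiv])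
    also have "\<dots> \<le> measure lebesgue V"
      using lmeasurable_division[OF rdiv] Vl rV by (intro measure_mono_fmeasurable) (auto simp: fmeasurableD)
    finally have len: "(\<Sum>(c, d)\<in>\<phi> ` r. d - c) < \<delta>"
      using mV by simp
    have dj: "disjoint_family_on (\<lambda>(c, d). {c<..<d}) (\<phi> ` r)"
      unfolding disjoint_family_on_def using disj by (fastforce simp: \<phi>_def)
    have bd: "\<forall>(c, d) \<in> \<phi> ` r. a \<le> c \<and> c \<le> d \<and> d \<le> b"
      using shape rq by (fastforce simp: \<phi>_def)
    have "(\<Sum>(x, K)\<in>q. norm (F (Sup K) - F (Inf K))) = (\<Sum>(x, K)\<in>r. norm (F (Sup K) - F (Inf K)))"
    proof (rule sum.mono_neutral_right[OF qD(1) rq])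
      show "\<forall>i\<in>q - r. (case i of (x, K) \<Rightarrow> norm (F (Sup K) - F (Inf K))) = 0"
      proof clarify
        fix x K assume "(x, K) \<in> q" "(x, K) \<notin> r"
        then have "Sup K = Inf K"
          using shape[of x K] by (auto simp: r_def)
        then show "norm (F (Sup K) - F (Inf K)) = 0"
          by simp
      qed
    qed
    also have "\<dots> = (\<Sum>(c, d)\<in>\<phi> ` r. norm (F d - F c))"
      unfolding sum.reindex[OF inj] by (intro sum.cong) (auto simp: \<phi>_def)
    also have "\<dots> < e"
      using \<delta>[OF _ bd dj len] fr by simp
    finally show "(\<Sum>(x, K)\<in>q. norm (F (Sup K) - F (Inf K))) < e" .
  qed
qed

text \<open>
  The gauge is built in two parts. At points off \<open>N\<close> it comes from the derivative, as in the classical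
  fundamental theorem, and the error over all such tags is at most \<open>e / 2\<close>. At points of \<open>N\<close> it is the open
  set of the preceding lemma, so these intervals contribute at most \<open>e / 2\<close> as well. Integrability of
  \<open>F'\<close> is part of the conclusion.
\<close>
lemma absolutely_continuous_fun_has_integral:
  fixes F :: "real \<Rightarrow> 'a::banach"
  assumes ac: "absolutely_continuous_fun a b F" and "a \<le> b" and N: "negligible N"
    and deriv: "\<And>t. t \<in> {a..b} - N \<Longrightarrow> (F has_vector_derivative F' t) (at t within {a..b})"
  shows "(F' has_integral (F b - F a)) {a..b}"
proof -
  \<comment> \<open>On the null set the values of the integrand are irrelevant for the integral; zero removes the tags in \<open>N\<close> from the Riemann sums.\<close>
  define G where "G t = (if t \<in> N then 0 else F' t)" for t
  have "(G has_integral (F b - F a)) (cbox a b)"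
    unfolding has_integral
  proof (intro allI impI)
    fix e :: real assume "e > 0"
    define \<epsilon> where "\<epsilon> = e / (2 * (b - a + 1))"
    have "\<epsilon> > 0"
      using \<open>e > 0\<close> \<open>a \<le> b\<close> by (simp add: \<epsilon>_def)
    have "\<epsilon> * (b - a) = (e / 2) * ((b - a) / (b - a + 1))"
      using \<open>a \<le> b\<close> by (simp add: \<epsilon>_def field_simps)
    also have "\<dots> \<le> (e / 2) * 1"
      using \<open>a \<le> b\<close> \<open>e > 0\<close> by (intro mult_left_mono) auto
    finally have eb: "\<epsilon> * (b - a) \<le> e / 2" by simp
    have "\<forall>x. \<exists>d>0. x \<in> {a..b} - N \<longrightarrow>
        (\<forall>y\<in>{a..b}. norm (y - x) < d \<longrightarrow> norm (F y - F x - (y - x) *\<^sub>R F' x) \<le> \<epsilon> * norm (y - x))"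
      using deriv[unfolded has_vector_derivative_def has_derivative_within_alt] \<open>\<epsilon> > 0\<close> by blast
    then obtain d where d: "\<And>x. 0 < d x"
      "\<And>x y. \<lbrakk>x \<in> {a..b} - N; y \<in> {a..b}; norm (y - x) < d x\<rbrakk>
         \<Longrightarrow> norm (F y - F x - (y - x) *\<^sub>R F' x) \<le> \<epsilon> * norm (y - x)"
      by metis
    obtain V where V: "open V" "N \<subseteq> V"
      "\<And>q. q tagged_partial_division_of {a..b} \<Longrightarrow> (\<And>x K. (x, K) \<in> q \<Longrightarrow> K \<subseteq> V) \<Longrightarrow>
         (\<Sum>(x, K)\<in>q. norm (F (Sup K) - F (Inf K))) < e / 2"
      using absolutely_continuous_fun_small_on_tags[OF ac N, of "e / 2"] \<open>e > 0\<close> by auto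
    define \<gamma> where "\<gamma> x = (if x \<in> N then V else ball x (d x))" for x
    show "\<exists>\<gamma>. gauge \<gamma> \<and> (\<forall>p. p tagged_division_of cbox a b \<and> \<gamma> fine p \<longrightarrow>
             norm ((\<Sum>(x, K)\<in>p. measure lborel K *\<^sub>R G x) - (F b - F a)) < e)"
    proof (intro exI[of _ \<gamma>] conjI allI impI; (elim conjE)?)
      show "gauge \<gamma>"
        using V(1,2) d(1) by (auto simp: gauge_def \<gamma>_def)
    next
      fix p assume p: "p tagged_division_of cbox a b" and fine: "\<gamma> fine p"
      define R where "R x K = measure lborel K *\<^sub>R G x - (F (Sup K) - F (Inf K))" for x K
      define q where "q = {(x, K) \<in> p. x \<in> N}"
      have qp: "q \<subseteq> p" and fp: "finite p"
        using p by (auto simp: q_def tagged_division_of_finite)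
      have tel: "b - a = (\<Sum>(x, K)\<in>p. Sup K - Inf K)"
        "F b - F a = (\<Sum>(x, K)\<in>p. F (Sup K) - F (Inf K))"
        using additive_tagged_division_1[where f = "\<lambda>x. x"] additive_tagged_division_1[where f = F]
          \<open>a \<le> b\<close> p by auto
      have good: "norm (R x K) \<le> \<epsilon> * (Sup K - Inf K)" if xK: "(x, K) \<in> p - q" for x K
      proof -
        have "(x, K) \<in> p"
          using xK by simp
        then obtain u v where K: "K = {u..v}" and "x \<in> K" and kab: "K \<subseteq> {a..b}"
          using tagged_division_ofD(2,3,4)[OF p, of x K] by auto
        then have uv: "u \<le> x" "x \<le> v"
          by auto
        have "x \<notin> N"
          using that by (auto simp: q_def)
        then have Kball: "K \<subseteq> ball x (d x)"
          using fineD[OF fine \<open>(x, K) \<in> p\<close>] by (simp add: \<gamma>_def)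
        have xs: "x \<in> {a..b} - N" "u \<in> {a..b}" "v \<in> {a..b}"
          using kab uv \<open>x \<notin> N\<close> K by auto
        have near: "norm (u - x) < d x" "norm (v - x) < d x"
          using Kball uv K by (force simp: subset_iff dist_real_def abs_minus_commute)+
        have "R x K = (F u - F x - (u - x) *\<^sub>R F' x) - (F v - F x - (v - x) *\<^sub>R F' x)"
          using uv \<open>x \<notin> N\<close> by (simp add: R_def G_def K algebra_simps)
        also have "norm \<dots> \<le> \<epsilon> * norm (u - x) + \<epsilon> * norm (v - x)"
          using d(2)[OF xs(1,2) near(1)] d(2)[OF xs(1,3) near(2)]
          by (meson add_mono norm_triangle_ineq4 order_trans)
        also have "\<dots> = \<epsilon> * (Sup K - Inf K)"
          using uv by (simp add: K algebra_simps)
        finally show ?thesis .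
      qed
      have bad: "(\<Sum>(x, K)\<in>q. norm (F (Sup K) - F (Inf K))) < e / 2"
      proof (rule V(3))
        show "q tagged_partial_division_of {a..b}"
          using p qp tagged_partial_division_subset unfolding tagged_division_of_def by fastforce
        show "\<And>x K. (x, K) \<in> q \<Longrightarrow> K \<subseteq> V"
          using fineD[OF fine] by (fastforce simp: q_def \<gamma>_def)
      qed
      have "(\<Sum>(x, K)\<in>p. measure lborel K *\<^sub>R G x) - (F b - F a) = (\<Sum>(x, K)\<in>p. R x K)"
        by (simp add: tel(2) R_def case_prod_unfold sum_subtractf)
      also have "\<dots> = (\<Sum>(x, K)\<in>p - q. R x K) + (\<Sum>(x, K)\<in>q. R x K)"
        using sum.subset_diff[OF qp fp] by auto
      also have "norm \<dots> \<le> (\<Sum>(x, K)\<in>p - q. \<epsilon> * (Sup K - Inf K)) + (\<Sum>(x, K)\<in>q. norm (F (Sup K) - F (Inf K)))"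
      proof (rule norm_triangle_mono; rule sum_norm_le)
        show "\<And>s. s \<in> p - q \<Longrightarrow> norm (case s of (x, K) \<Rightarrow> R x K) \<le> (case s of (x, K) \<Rightarrow> \<epsilon> * (Sup K - Inf K))"
          using good by auto
        show "\<And>s. s \<in> q \<Longrightarrow> norm (case s of (x, K) \<Rightarrow> R x K) \<le> (case s of (x, K) \<Rightarrow> norm (F (Sup K) - F (Inf K)))"
          by (auto simp: q_def R_def G_def norm_minus_commute)
      qed
      also have "\<dots> < \<epsilon> * (b - a) + e / 2"
      proof (rule add_le_less_mono[OF _ bad])
        have "(\<Sum>(x, K)\<in>p - q. \<epsilon> * (Sup K - Inf K)) \<le> (\<Sum>(x, K)\<in>p. \<epsilon> * (Sup K - Inf K))"
        proof (rule sum_mono2[OF fp])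
          fix s assume "s \<in> p - (p - q)"
          then obtain x K where s: "s = (x, K)" "(x, K) \<in> p"
            by (cases s) auto
          then obtain u v where "K = {u..v}" "x \<in> K"
            using tagged_division_ofD(2,4)[OF p, of x K] by auto
          then show "0 \<le> (case s of (x, K) \<Rightarrow> \<epsilon> * (Sup K - Inf K))"
            using \<open>\<epsilon> > 0\<close> s(1) by auto
        qed auto
        also have "\<dots> = \<epsilon> * (b - a)"
          by (simp add: tel(1) sum_distrib_left case_prod_unfold)
        finally show "(\<Sum>(x, K)\<in>p - q. \<epsilon> * (Sup K - Inf K)) \<le> \<epsilon> * (b - a)" .
      qed
      also have "\<dots> \<le> e"
        using eb by simp
      finally show "norm ((\<Sum>(x, K)\<in>p. measure lborel K *\<^sub>R G x) - (F b - F a)) < e" .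
    qed
  qed
  then show ?thesis
    using has_integral_spike[OF N, of "{a..b}" F' G] by (auto simp: G_def)
qed

lemma absolutely_continuous_fun_imp_continuous_on:
  assumes "absolutely_continuous_fun a b F"
  shows "continuous_on {a..b} F"
  unfolding continuous_on_iff
proof (intro ballI allI impI)
  fix x \<epsilon> :: real assume "x \<in> {a..b}" "\<epsilon> > 0"
  obtain \<delta> where "\<delta> > 0" and \<delta>: "\<And>D :: (real \<times> real) set.
       finite D \<Longrightarrow> (\<forall>(c, d) \<in> D. a \<le> c \<and> c \<le> d \<and> d \<le> b) \<Longrightarrow>
       disjoint_family_on (\<lambda>(c, d). {c<..<d}) D \<Longrightarrow> (\<Sum>(c, d)\<in>D. d - c) < \<delta>
       \<Longrightarrow> (\<Sum>(c, d)\<in>D. norm (F d - F c)) < \<epsilon>"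
    using assms \<open>\<epsilon> > 0\<close> unfolding absolutely_continuous_fun_def by meson
  have "dist (F x') (F x) < \<epsilon>" if "x' \<in> {a..b}" "dist x' x < \<delta>" for x'
  proof (cases "x \<le> x'")
    case True
    then show ?thesis
      using \<delta>[of "{(x, x')}"] that \<open>x \<in> {a..b}\<close> by (auto simp: disjoint_family_on_def dist_norm)
  next
    case False
    then show ?thesis
      using \<delta>[of "{(x', x)}"] that \<open>x \<in> {a..b}\<close>
      by (auto simp: disjoint_family_on_def dist_norm norm_minus_commute)
  qed
  then show "\<exists>d>0. \<forall>x'\<in>{a..b}. dist x' x < d \<longrightarrow> dist (F x') (F x) < \<epsilon>"
    using \<open>\<delta> > 0\<close> by blast
qed

text \<open>
  The common core of the closure properties: increments of a sum or of an inner product are bounded by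
  those of the two operands, so the smaller of the two \<open>\<delta>\<close> serves for the result.
\<close>
lemma absolutely_continuous_fun_dominated:
  assumes acF: "absolutely_continuous_fun a b F" and acG: "absolutely_continuous_fun a b G"
    and "C \<ge> 0"
    and dom: "\<And>c d. a \<le> c \<Longrightarrow> c \<le> d \<Longrightarrow> d \<le> b \<Longrightarrow>
      norm (H d - H c) \<le> C * norm (F d - F c) + C * norm (G d - G c)"
  shows "absolutely_continuous_fun a b H"
  unfolding absolutely_continuous_fun_def
proof (intro allI impI)
  fix \<epsilon> :: real assume "\<epsilon> > 0"
  define \<epsilon>' where "\<epsilon>' = \<epsilon> / (2 * (C + 1))"
  have "\<epsilon>' > 0"
    using \<open>\<epsilon> > 0\<close> \<open>C \<ge> 0\<close> by (simp add: \<epsilon>'_def)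
  have e: "(C + 1) * \<epsilon>' = \<epsilon> / 2"
    using \<open>C \<ge> 0\<close> by (simp add: \<epsilon>'_def field_simps)
  let ?ok = "\<lambda>D \<delta>. finite D \<and> (\<forall>(c, d) \<in> D. a \<le> c \<and> c \<le> d \<and> d \<le> b) \<and>
     disjoint_family_on (\<lambda>(c, d). {c<..<d}) D \<and> (\<Sum>(c, d)\<in>D. d - c) < (\<delta> :: real)"
  obtain \<delta>1 where \<delta>1: "\<delta>1 > 0" "\<And>D. ?ok D \<delta>1 \<Longrightarrow> (\<Sum>(c, d)\<in>D. norm (F d - F c)) < \<epsilon>'"
    using acF \<open>\<epsilon>' > 0\<close> unfolding absolutely_continuous_fun_def by meson
  obtain \<delta>2 where \<delta>2: "\<delta>2 > 0" "\<And>D. ?ok D \<delta>2 \<Longrightarrow> (\<Sum>(c, d)\<in>D. norm (G d - G c)) < \<epsilon>'"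
    using acG \<open>\<epsilon>' > 0\<close> unfolding absolutely_continuous_fun_def by meson
  show "\<exists>\<delta>>0. \<forall>D. ?ok D \<delta> \<longrightarrow> (\<Sum>(c, d)\<in>D. norm (H d - H c)) < \<epsilon>"
  proof (intro exI[of _ "min \<delta>1 \<delta>2"] conjI allI impI)
    show "0 < min \<delta>1 \<delta>2"
      using \<delta>1 \<delta>2 by simp
    fix D assume D: "?ok D (min \<delta>1 \<delta>2)"
    have "(\<Sum>(c, d)\<in>D. norm (H d - H c))
        \<le> (\<Sum>(c, d)\<in>D. C * norm (F d - F c) + C * norm (G d - G c))"
      using dom D by (intro sum_mono) auto
    also have "\<dots> = C * (\<Sum>(c, d)\<in>D. norm (F d - F c)) + C * (\<Sum>(c, d)\<in>D. norm (G d - G c))"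
      by (simp add: case_prod_unfold sum.distrib sum_distrib_left)
    also have "\<dots> \<le> C * \<epsilon>' + C * \<epsilon>'"
      using \<delta>1(2)[of D] \<delta>2(2)[of D] D \<open>C \<ge> 0\<close>
      by (intro add_mono mult_left_mono) auto
    also have "\<dots> < \<epsilon>"
      using e \<open>\<epsilon>' > 0\<close> by (simp add: algebra_simps)
    finally show "(\<Sum>(c, d)\<in>D. norm (H d - H c)) < \<epsilon>" .
  qed
qed

lemma lipschitz_on_imp_absolutely_continuous_fun:
  assumes "L-lipschitz_on {a..b} F"
  shows "absolutely_continuous_fun a b F"
  unfolding absolutely_continuous_fun_def
proof (intro allI impI)
  fix \<epsilon> :: real assume "\<epsilon> > 0"
  have "L \<ge> 0"
    using assms by (rule lipschitz_on_nonneg)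
  show "\<exists>\<delta>>0. \<forall>D :: (real \<times> real) set. finite D \<and> (\<forall>(c, d) \<in> D. a \<le> c \<and> c \<le> d \<and> d \<le> b) \<and>
     disjoint_family_on (\<lambda>(c, d). {c<..<d}) D \<and> (\<Sum>(c, d)\<in>D. d - c) < \<delta> \<longrightarrow>
     (\<Sum>(c, d)\<in>D. norm (F d - F c)) < \<epsilon>"
  proof (intro exI[of _ "\<epsilon> / (L + 1)"] conjI allI impI)
    show "0 < \<epsilon> / (L + 1)"
      using \<open>\<epsilon> > 0\<close> \<open>L \<ge> 0\<close> by simp
    fix D :: "(real \<times> real) set"
    assume D: "finite D \<and> (\<forall>(c, d) \<in> D. a \<le> c \<and> c \<le> d \<and> d \<le> b) \<and>
     disjoint_family_on (\<lambda>(c, d). {c<..<d}) D \<and> (\<Sum>(c, d)\<in>D. d - c) < \<epsilon> / (L + 1)"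
    have "(\<Sum>(c, d)\<in>D. norm (F d - F c)) \<le> (\<Sum>(c, d)\<in>D. (L + 1) * (d - c))"
    proof (rule sum_mono, clarify)
      fix c d assume "(c, d) \<in> D"
      then have cd: "a \<le> c" "c \<le> d" "d \<le> b"
        using D by auto
      then have "norm (F d - F c) \<le> L * (d - c)"
        using lipschitz_onD[OF assms, of d c] by (simp add: dist_norm)
      also have "\<dots> \<le> (L + 1) * (d - c)"
        using cd by (intro mult_right_mono) auto
      finally show "norm (F d - F c) \<le> (L + 1) * (d - c)" .
    qed
    also have "\<dots> = (L + 1) * (\<Sum>(c, d)\<in>D. d - c)"
      by (simp add: case_prod_unfold sum_distrib_left)
    also have "\<dots> < \<epsilon>"
      using D \<open>L \<ge> 0\<close> by (simp add: pos_less_divide_eq mult.commute)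
    finally show "(\<Sum>(c, d)\<in>D. norm (F d - F c)) < \<epsilon>" .
  qed
qed

lemma absolutely_continuous_fun_add:
  assumes "absolutely_continuous_fun a b F" "absolutely_continuous_fun a b G"
  shows "absolutely_continuous_fun a b (\<lambda>t. F t + G t)"
  by (rule absolutely_continuous_fun_dominated[OF assms, of 1])
    (auto simp: norm_triangle_ineq intro: order_trans[OF eq_refl norm_triangle_ineq] simp: add_diff_add)

lemma absolutely_continuous_fun_inner:
  fixes F G :: "real \<Rightarrow> 'a::real_inner"
  assumes acF: "absolutely_continuous_fun a b F" and acG: "absolutely_continuous_fun a b G"
  shows "absolutely_continuous_fun a b (\<lambda>t. F t \<bullet> G t)"
proof -
  have "bounded (F ` {a..b})" "bounded (G ` {a..b})"
    using assms absolutely_continuous_fun_imp_continuous_on compact_continuous_image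
      compact_imp_bounded compact_Icc by metis+
  then obtain B1 B2 where B: "\<And>t. t \<in> {a..b} \<Longrightarrow> norm (F t) \<le> B1" "\<And>t. t \<in> {a..b} \<Longrightarrow> norm (G t) \<le> B2"
    unfolding bounded_iff by fastforce
  define C where "C = max 0 (max B1 B2)"
  have C: "norm (F t) \<le> C" "norm (G t) \<le> C" if "t \<in> {a..b}" for t
    using B[OF that] by (auto simp: C_def)
  show ?thesis
  proof (rule absolutely_continuous_fun_dominated[OF assms])
    show "C \<ge> 0" by (simp add: C_def)
    fix c d assume cd: "a \<le> c" "c \<le> d" "d \<le> b"
    have "F d \<bullet> G d - F c \<bullet> G c = (F d - F c) \<bullet> G d + F c \<bullet> (G d - G c)"
      by (simp add: algebra_simps)
    also have "norm \<dots> \<le> norm (F d - F c) * norm (G d) + norm (F c) * norm (G d - G c)"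
      using Cauchy_Schwarz_ineq2[of "F d - F c" "G d"] Cauchy_Schwarz_ineq2[of "F c" "G d - G c"]
      by (intro norm_triangle_mono) simp_all
    also have "\<dots> \<le> norm (F d - F c) * C + C * norm (G d - G c)"
      using C[of d] C[of c] cd by (intro add_mono mult_left_mono mult_right_mono) auto
    finally show "norm (F d \<bullet> G d - F c \<bullet> G c) \<le> C * norm (F d - F c) + C * norm (G d - G c)"
      by (simp add: mult.commute)
  qed
qed

text \<open>
  The Lipschitz constant is a bound of \<open>w'\<close> on the compact interval, by the mean value theorem, which asks
  for derivatives in the interior and continuity up to the endpoints.
\<close>
lemma lipschitz_on_of_bounded_interior_derivative:
  fixes w :: "real \<Rightarrow> 'a::real_inner"
  assumes w: "continuous_on {a..b} w" and w': "continuous_on {a..b} w'"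
    and der: "\<And>t. a < t \<Longrightarrow> t < b \<Longrightarrow> (w has_vector_derivative w' t) (at t)"
  obtains L where "L-lipschitz_on {a..b} w"
proof -
  have "bounded (w' ` {a..b})"
    using w' compact_continuous_image compact_imp_bounded compact_Icc by metis
  then obtain B where B: "B > 0" "\<And>t. t \<in> {a..b} \<Longrightarrow> norm (w' t) \<le> B"
    unfolding bounded_pos by auto
  have main: "dist (w s) (w t) \<le> B * dist s t" if st: "s \<in> {a..b}" "t \<in> {a..b}" "s < t" for s t
  proof -
    have "\<exists>x\<in>{s<..<t}. norm (w t - w s) \<le> norm ((t - s) *\<^sub>R w' x)"
    proof (rule mvt_general[OF st(3), where f' = "\<lambda>x h. h *\<^sub>R w' x"])
      show "continuous_on {s..t} w"
        using st by (intro continuous_on_subset[OF w]) auto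
      show "(w has_derivative (\<lambda>h. h *\<^sub>R w' x)) (at x)" if "s < x" "x < t" for x
        using der[of x] st that by (simp add: has_vector_derivative_def)
    qed
    then obtain x where x: "x \<in> {s<..<t}" "norm (w t - w s) \<le> (t - s) * norm (w' x)"
      using st by auto
    have "(t - s) * norm (w' x) \<le> (t - s) * B"
      using x st by (intro mult_left_mono B) auto
    then have "norm (w t - w s) \<le> B * (t - s)"
      using x(2) by (metis mult.commute order_trans)
    then show ?thesis
      using st by (simp add: dist_norm norm_minus_commute)
  qed
  have "B-lipschitz_on {a..b} w"
  proof (rule lipschitz_onI)
    show "dist (w s) (w t) \<le> B * dist s t" if "s \<in> {a..b}" "t \<in> {a..b}" for s t
      using main[of s t] main[of t s] that by (cases s t rule: linorder_cases) (auto simp: dist_commute)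
  qed (use B in simp)
  then show thesis
    by (rule that)
qed

section \<open>Chain rule and mean value formula for continuous partial derivatives\<close>

lemma continuous_on_along_curve:
  assumes "continuous_on U (\<lambda>(y, z, t). J y z t)"
    and "continuous_on S p" "continuous_on S q" "continuous_on S \<tau>"
    and "\<And>s. s \<in> S \<Longrightarrow> (p s, q s, \<tau> s) \<in> U"
  shows "continuous_on S (\<lambda>s. J (p s) (q s) (\<tau> s))"
  using continuous_on_compose2[OF assms(1), of S "\<lambda>s. (p s, q s, \<tau> s)"] assms(2-)
  by (simp add: continuous_on_Pair image_subset_iff)

text \<open>
  A relatively open subset of the time slab contains, around each of its points, a product of balls
  cut off at the times \<open>0\<close> and \<open>T\<close>. The state variables can be moved in full balls even at the two end
  times, so that derivatives in \<open>y\<close> and \<open>z\<close> are two-sided there.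
\<close>
lemma openin_time_slab_nbhd:
  fixes T :: real
  assumes "openin (top_of_set (UNIV \<times> UNIV \<times> {0..T})) U" and "(y, z, t) \<in> U"
  obtains r where "r > 0" "t \<in> {0..T}"
    "\<forall>u\<in>ball y r. \<forall>v\<in>ball z r. \<forall>s\<in>ball t r \<inter> {0..T}. (u, v, s) \<in> U"
proof -
  obtain V where V: "open V" "U = (UNIV \<times> UNIV \<times> {0..T}) \<inter> V"
    using assms(1) by (auto simp: openin_open)
  then have p: "(y, z, t) \<in> V" "t \<in> {0..T}"
    using assms(2) by auto
  obtain A B where AB: "open A" "open B" "y \<in> A" "(z, t) \<in> B" "A \<times> B \<subseteq> V"
    using open_prod_elim[OF V(1) p(1)] by (metis mem_Sigma_iff)
  obtain C D where CD: "open C" "open D" "z \<in> C" "t \<in> D" "C \<times> D \<subseteq> B"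
    using open_prod_elim[OF AB(2,4)] by (metis mem_Sigma_iff)
  obtain r1 where r1: "r1 > 0" "ball y r1 \<subseteq> A"
    using AB by (meson open_contains_ball)
  obtain r2 where r2: "r2 > 0" "ball z r2 \<subseteq> C"
    using CD by (meson open_contains_ball)
  obtain r3 where r3: "r3 > 0" "ball t r3 \<subseteq> D"
    using CD by (meson open_contains_ball)
  show thesis
  proof (rule that)
    show "min r1 (min r2 r3) > 0" "t \<in> {0..T}"
      using r1 r2 r3 p by auto
    show "\<forall>u\<in>ball y (min r1 (min r2 r3)). \<forall>v\<in>ball z (min r1 (min r2 r3)).
        \<forall>s\<in>ball t (min r1 (min r2 r3)) \<inter> {0..T}. (u, v, s) \<in> U"
    proof (intro ballI)
      fix u v s
      assume *: "u \<in> ball y (min r1 (min r2 r3))" "v \<in> ball z (min r1 (min r2 r3))"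
        "s \<in> ball t (min r1 (min r2 r3)) \<inter> {0..T}"
      then have "u \<in> A" "v \<in> C" "s \<in> D"
        using r1 r2 r3 by auto
      then have "(u, v, s) \<in> V"
        using AB CD by blast
      then show "(u, v, s) \<in> U"
        using V(2) * by auto
    qed
  qed
qed

lemma openin_time_slab_nbhd_interior:
  fixes T :: real
  assumes "openin (top_of_set (UNIV \<times> UNIV \<times> {0..T})) U" and "(y, z, t) \<in> U" and "0 < t" "t < T"
  obtains r where "r > 0" "ball t r \<subseteq> {0<..<T}"
    "\<forall>u\<in>ball y r. \<forall>v\<in>ball z r. \<forall>s\<in>ball t r. (u, v, s) \<in> U"
proof -
  obtain r where r: "r > 0" "t \<in> {0..T}"
    "\<forall>u\<in>ball y r. \<forall>v\<in>ball z r. \<forall>s\<in>ball t r \<inter> {0..T}. (u, v, s) \<in> U"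
    using openin_time_slab_nbhd[OF assms(1,2)] by metis
  define r' where "r' = min r (min t (T - t))"
  have b: "ball t r' \<subseteq> {0<..<T}"
    by (auto simp: r'_def dist_real_def)
  then have b': "ball t r' \<subseteq> {0..T}"
    by fastforce
  show thesis
  proof (rule that[of r'])
    show "r' > 0"
      using r(1) assms by (simp add: r'_def)
    show "ball t r' \<subseteq> {0<..<T}" by (rule b)
    show "\<forall>u\<in>ball y r'. \<forall>v\<in>ball z r'. \<forall>s\<in>ball t r'. (u, v, s) \<in> U"
      using b' by (intro ballI r(3)[rule_format]) (auto simp: r'_def)
  qed
qed

lemma has_derivative_jac_y:
  "(\<lambda>u. F u z t) differentiable (at y) \<Longrightarrow> ((\<lambda>u. F u z t) has_derivative (*v) (jac_y F y z t)) (at y)"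
  unfolding jac_y_def by (simp add: jacobian_works[symmetric])

lemma has_derivative_jac_z:
  "(\<lambda>v. F y v t) differentiable (at z) \<Longrightarrow> ((\<lambda>v. F y v t) has_derivative (*v) (jac_z F y z t)) (at z)"
  unfolding jac_z_def by (simp add: jacobian_works[symmetric])

lemma has_vector_derivative_der_t:
  "(\<lambda>\<tau>. F y z \<tau>) differentiable (at t within {0..T}) \<Longrightarrow>
   ((\<lambda>\<tau>. F y z \<tau>) has_vector_derivative der_t T F y z t) (at t within {0..T})"
  unfolding der_t_def by (simp add: vector_derivative_works[symmetric])

lemma C1_in_yzD:
  assumes "C1_in_yz U F" "(y, z, t) \<in> U"
  shows "((\<lambda>u. F u z t) has_derivative (*v) (jac_y F y z t)) (at y)"
    "((\<lambda>v. F y v t) has_derivative (*v) (jac_z F y z t)) (at z)"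
  using assms unfolding C1_in_yz_def by (auto intro!: has_derivative_jac_y has_derivative_jac_z)

lemma C1_in_yztD:
  assumes "C1_in_yzt T U F"
  shows "C1_in_yz U F"
    "(y, z, t) \<in> U \<Longrightarrow> 0 < t \<Longrightarrow> t < T \<Longrightarrow> ((\<lambda>\<tau>. F y z \<tau>) has_vector_derivative der_t T F y z t) (at t)"
proof -
  show "C1_in_yz U F"
    using assms by (simp add: C1_in_yzt_def)
  assume *: "(y, z, t) \<in> U" "0 < t" "t < T"
  have "(\<lambda>\<tau>. F y z \<tau>) differentiable (at t within {0..T})"
    using assms * by (auto simp: C1_in_yzt_def)
  from has_vector_derivative_der_t[of F y z t T, OF this]
  show "((\<lambda>\<tau>. F y z \<tau>) has_vector_derivative der_t T F y z t) (at t)"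
    using * at_within_interior[of t "{0..T}"] by simp
qed

text \<open>
  Transfers continuity of a Jacobian matrix to continuity of the operator that it represents, which is the
  form in which the criterion for total differentiability uses it.
\<close>
lemma bounded_linear_Blinfun_matrix:
  "bounded_linear (\<lambda>M :: real^'a^'b. Blinfun ((*v) M))"
proof -
  have "linear (\<lambda>M :: real^'a^'b. Blinfun ((*v) M))"
    by (rule linearI; rule blinfun_eqI)
      (simp_all add: bounded_linear_Blinfun_apply blinfun.bilinear_simps algebra_simps
        scaleR_matrix_vector_assoc)
  then show ?thesis
    by (simp add: linear_conv_bounded_linear)
qed

lemma bounded_linear_matrix_apply: "bounded_linear (\<lambda>M :: real^'a^'b. M *v x)"
  using bounded_linear_compose[OF blinfun.bounded_linear_left bounded_linear_Blinfun_matrix, of x]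
  by (simp add: bounded_linear_Blinfun_apply)

text \<open>
  Existing partial derivatives give a total derivative as soon as one of them is continuous, here the one
  in \<open>z\<close>.
\<close>
lemma C1_in_yz_has_total_derivative:
  assumes U: "openin (top_of_set (UNIV \<times> UNIV \<times> {0..T})) U" and C1: "C1_in_yz U F"
    and p: "(y, z, t) \<in> U"
  shows "((\<lambda>(u, v). F u v t) has_derivative (\<lambda>(a, b). jac_y F y z t *v a + jac_z F y z t *v b)) (at (y, z))"
proof -
  obtain r where r: "r > 0" "t \<in> {0..T}"
    "\<forall>u\<in>ball y r. \<forall>v\<in>ball z r. \<forall>s\<in>ball t r \<inter> {0..T}. (u, v, s) \<in> U"
    using openin_time_slab_nbhd[OF U p] by metis
  have rU: "(u, v, t) \<in> U" if "u \<in> ball y r" "v \<in> ball z r" for u v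
    using r that by simp
  have cJ: "continuous_on U (\<lambda>(y, z, t). jac_z F y z t)"
    using C1 by (simp add: C1_in_yz_def)
  have "continuous_on (ball y r \<times> ball z r) (\<lambda>w. jac_z F (fst w) (snd w) t)"
    by (rule continuous_on_along_curve[OF cJ]) (auto intro!: continuous_intros rU)
  then have cB: "continuous_on (ball y r \<times> ball z r) (\<lambda>w. Blinfun ((*v) (jac_z F (fst w) (snd w) t)))"
    by (rule bounded_linear.continuous_on[OF bounded_linear_Blinfun_matrix])
  have "((\<lambda>(u, v). F u v t) has_derivative
      (\<lambda>(a, b). jac_y F y z t *v a + blinfun_apply (Blinfun ((*v) (jac_z F y z t))) b))
      (at (y, z) within ball y r \<times> ball z r)"
  proof (rule has_derivative_partialsI[where f = "\<lambda>u v. F u v t"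
        and fy = "\<lambda>u v. Blinfun ((*v) (jac_z F u v t))"])
    show "((\<lambda>u. F u z t) has_derivative (*v) (jac_y F y z t)) (at y within ball y r)"
      using C1_in_yzD(1)[OF C1 p] by (rule has_derivative_at_withinI)
    show "((\<lambda>v. F u v t) has_derivative blinfun_apply (Blinfun ((*v) (jac_z F u v t)))) (at v within ball z r)"
      if "u \<in> ball y r" "v \<in> ball z r" for u v
      using C1_in_yzD(2)[OF C1 rU[OF that]]
      by (simp add: bounded_linear_Blinfun_apply has_derivative_at_withinI)
    show "continuous (at (y, z) within ball y r \<times> ball z r) (\<lambda>(u, v). Blinfun ((*v) (jac_z F u v t)))"
      using cB r(1) by (auto simp: continuous_on_eq_continuous_within case_prod_unfold)
  qed (use r in auto)
  moreover have "open (ball y r \<times> ball z r)" "(y, z) \<in> ball y r \<times> ball z r"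
    using r by (auto intro: open_Times)
  ultimately show ?thesis
    using at_within_open by (metis (no_types, lifting) ext bounded_linear_Blinfun_apply matrix_vector_mul_bounded_linear)
qed

text \<open>
  The total derivative in \<open>(y, z)\<close> at the fixed time is combined with the continuous time derivative.
  The states are paired as \<open>((y, z), t)\<close> to apply the two-variable criterion a second time.
\<close>
lemma C1_in_yzt_has_total_derivative:
  assumes U: "openin (top_of_set (UNIV \<times> UNIV \<times> {0..T})) U" and C1: "C1_in_yzt T U F"
    and p: "(y, z, t) \<in> U" and t: "0 < t" "t < T"
  shows "((\<lambda>(w, s). F (fst w) (snd w) s) has_derivative
      (\<lambda>(c, s). (jac_y F y z t *v fst c + jac_z F y z t *v snd c) + s *\<^sub>R der_t T F y z t)) (at ((y, z), t))"
proof -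
  obtain r where r: "r > 0" "ball t r \<subseteq> {0<..<T}"
    "\<forall>u\<in>ball y r. \<forall>v\<in>ball z r. \<forall>s\<in>ball t r. (u, v, s) \<in> U"
    using openin_time_slab_nbhd_interior[OF U p t] by metis
  have cJ: "continuous_on U (\<lambda>(y, z, t). der_t T F y z t)"
    using C1 by (simp add: C1_in_yzt_def)
  let ?X = "ball y r \<times> ball z r"
  have "continuous_on (?X \<times> ball t r) (\<lambda>w. der_t T F (fst (fst w)) (snd (fst w)) (snd w))"
    by (rule continuous_on_along_curve[OF cJ]) (auto intro!: continuous_intros r(3)[rule_format])
  then have cB: "continuous_on (?X \<times> ball t r)
      (\<lambda>w. blinfun_scaleR_left (der_t T F (fst (fst w)) (snd (fst w)) (snd w)))"
    by (rule bounded_linear.continuous_on[OF bounded_linear_blinfun_scaleR_left])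
  let ?fy = "\<lambda>w s. blinfun_scaleR_left (der_t T F (fst w) (snd w) s)"
  have 1: "((\<lambda>w. F (fst w) (snd w) t) has_derivative
      (\<lambda>c. jac_y F y z t *v fst c + jac_z F y z t *v snd c)) (at (y, z) within ?X)"
    using has_derivative_at_withinI[OF C1_in_yz_has_total_derivative[OF U C1_in_yztD(1)[OF C1] p]]
    by (simp add: case_prod_unfold)
  have 2: "((\<lambda>s. F (fst w) (snd w) s) has_derivative blinfun_apply (?fy w s)) (at s within ball t r)"
    if "w \<in> ?X" "s \<in> ball t r" for w s
  proof -
    have "(fst w, snd w, s) \<in> U" "0 < s" "s < T"
      using that r by (auto intro!: r(3)[rule_format])
    from C1_in_yztD(2)[OF C1 this] show ?thesis
      unfolding has_vector_derivative_def blinfun_scaleR_left.rep_eq by (rule has_derivative_at_withinI)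
  qed
  have 3: "continuous (at ((y, z), t) within ?X \<times> ball t r) (\<lambda>(w, s). ?fy w s)"
    using cB r(1) by (auto simp: continuous_on_eq_continuous_within case_prod_unfold)
  have "((\<lambda>(w, s). F (fst w) (snd w) s) has_derivative
      (\<lambda>(c, s). (jac_y F y z t *v fst c + jac_z F y z t *v snd c) + blinfun_apply (?fy (y, z) t) s))
      (at ((y, z), t) within ?X \<times> ball t r)"
    by (rule has_derivative_partialsI[where f = "\<lambda>w s. F (fst w) (snd w) s" and fy = ?fy, OF 1 2 3])
      (use r(1) in auto)
  moreover have "at ((y, z), t) within ?X \<times> ball t r = at ((y, z), t)"
    using r(1) by (intro at_within_open open_Times) auto
  ultimately show ?thesis
    by (simp only: blinfun_scaleR_left.rep_eq fst_conv snd_conv)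
qed

lemma C1_in_yzt_chain_rule:
  assumes U: "openin (top_of_set (UNIV \<times> UNIV \<times> {0..T})) U" and C1: "C1_in_yzt T U F"
    and p: "(y t, z t, t) \<in> U" and t: "0 < t" "t < T"
    and y: "(y has_vector_derivative y') (at t)" and z: "(z has_vector_derivative z') (at t)"
  shows "((\<lambda>s. F (y s) (z s) s) has_vector_derivative
      jac_y F (y t) (z t) t *v y' + jac_z F (y t) (z t) t *v z' + der_t T F (y t) (z t) t) (at t)"
proof -
  have "((\<lambda>s. ((y s, z s), s)) has_vector_derivative ((y', z'), 1)) (at t)"
    using y z by (intro has_vector_derivative_Pair) auto
  from vector_derivative_diff_chain_within[OF this has_derivative_at_withinI[OF
      C1_in_yzt_has_total_derivative[OF U C1 p t]]]
  show ?thesis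
    by (simp add: o_def)
qed

text \<open>
  The difference of the values is the integral over \<open>s \<in> [0, 1]\<close> of the derivative of \<open>F\<close> along the
  segment. The direction of the segment does not depend on \<open>s\<close>, so it can be taken out of the integral.
\<close>
lemma segment_average_mean_value:
  assumes U: "openin (top_of_set (UNIV \<times> UNIV \<times> {0..T})) U" and C1: "C1_in_yz U F"
    and seg: "\<And>s. s \<in> {0..1} \<Longrightarrow>
        (s *\<^sub>R y t + (1 - s) *\<^sub>R Y t, s *\<^sub>R z t + (1 - s) *\<^sub>R Z t, t) \<in> U"
  shows "F (y t) (z t) t - F (Y t) (Z t) t =
      segment_average (jac_y F) y z Y Z t *v (y t - Y t) + segment_average (jac_z F) y z Y Z t *v (z t - Z t)"
proof -
  define p where "p s = s *\<^sub>R y t + (1 - s) *\<^sub>R Y t" for s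
  define q where "q s = s *\<^sub>R z t + (1 - s) *\<^sub>R Z t" for s
  define Jy where "Jy s = jac_y F (p s) (q s) t" for s
  define Jz where "Jz s = jac_z F (p s) (q s) t" for s
  have pq: "(p s, q s, t) \<in> U" if "s \<in> {0..1}" for s
    using seg[OF that] by (simp add: p_def q_def)
  have der: "((\<lambda>s. F (p s) (q s) t) has_vector_derivative Jy s *v (y t - Y t) + Jz s *v (z t - Z t)) (at s within {0..1})"
    if "s \<in> {0..1}" for s
  proof -
    have "((\<lambda>s. (p s, q s)) has_vector_derivative (y t - Y t, z t - Z t)) (at s within {0..1})"
      unfolding p_def q_def
      by (intro has_vector_derivative_Pair) (auto intro!: derivative_eq_intros simp: algebra_simps)
    from vector_derivative_diff_chain_within[OF this has_derivative_at_withinI[OF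
        C1_in_yz_has_total_derivative[OF U C1 pq[OF that]]]]
    show ?thesis
      by (simp add: o_def Jy_def Jz_def)
  qed
  have cont: "continuous_on {0..1} p" "continuous_on {0..1} q"
    unfolding p_def q_def by (intro continuous_intros)+
  have int: "(\<lambda>s. J (p s) (q s) t) integrable_on {0..1}"
    if "continuous_on U (\<lambda>(y, z, t). J y z t)" for J :: "_ \<Rightarrow> _ \<Rightarrow> _ \<Rightarrow> real^'x^'w"
    by (intro integrable_continuous_real continuous_on_along_curve[OF that] cont continuous_on_const pq)
  have Jint: "(Jy has_integral segment_average (jac_y F) y z Y Z t) {0..1}"
    "(Jz has_integral segment_average (jac_z F) y z Y Z t) {0..1}"
    using C1 int[of "jac_y F"] int[of "jac_z F"] unfolding segment_average_def p_def[symmetric] q_def[symmetric] Jy_def Jz_def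
    by (auto simp: C1_in_yz_def intro!: integrable_integral)
  from has_integral_add[OF has_integral_linear[OF Jint(1) bounded_linear_matrix_apply[of "y t - Y t"], unfolded o_def]
      has_integral_linear[OF Jint(2) bounded_linear_matrix_apply[of "z t - Z t"], unfolded o_def]]
  have 1: "((\<lambda>s. Jy s *v (y t - Y t) + Jz s *v (z t - Z t)) has_integral
     segment_average (jac_y F) y z Y Z t *v (y t - Y t) + segment_average (jac_z F) y z Y Z t *v (z t - Z t)) {0..1}" .
  have "((\<lambda>s. Jy s *v (y t - Y t) + Jz s *v (z t - Z t)) has_integral
     F (p 1) (q 1) t - F (p 0) (q 0) t) {0..1}"
    by (rule fundamental_theorem_of_calculus[OF _ der]) auto
  from has_integral_unique[OF this 1] show ?thesis
    by (simp add: p_def q_def)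
qed

section \<open>Symmetry of mixed second derivatives\<close>

text \<open>
  The double difference of \<open>\<phi>\<close> over a small square with side \<open>h\<close> equals \<open>h\<^sup>2\<close> times a value of \<open>\<phi>12\<close> and also
  \<open>h\<^sup>2\<close> times a value of \<open>\<phi>21\<close>, by two applications of the mean value theorem in either order. Continuity
  of both mixed derivatives lets the square shrink to the point.
\<close>
lemma mixed_partials_commute:
  fixes \<phi> :: "real \<Rightarrow> real \<Rightarrow> real"
  assumes "r > 0"
    and d1: "\<And>a b. a \<in> ball a0 r \<Longrightarrow> b \<in> ball b0 r \<Longrightarrow> ((\<lambda>x. \<phi> x b) has_real_derivative \<phi>1 a b) (at a)"
    and d2: "\<And>a b. a \<in> ball a0 r \<Longrightarrow> b \<in> ball b0 r \<Longrightarrow> ((\<lambda>x. \<phi> a x) has_real_derivative \<phi>2 a b) (at b)"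
    and d12: "\<And>a b. a \<in> ball a0 r \<Longrightarrow> b \<in> ball b0 r \<Longrightarrow> ((\<lambda>x. \<phi>1 a x) has_real_derivative \<phi>12 a b) (at b)"
    and d21: "\<And>a b. a \<in> ball a0 r \<Longrightarrow> b \<in> ball b0 r \<Longrightarrow> ((\<lambda>x. \<phi>2 x b) has_real_derivative \<phi>21 a b) (at a)"
    and c12: "continuous_on (ball a0 r \<times> ball b0 r) (\<lambda>(a, b). \<phi>12 a b)"
    and c21: "continuous_on (ball a0 r \<times> ball b0 r) (\<lambda>(a, b). \<phi>21 a b)"
  shows "\<phi>12 a0 b0 = \<phi>21 a0 b0"
proof -
  have "\<bar>\<phi>12 a0 b0 - \<phi>21 a0 b0\<bar> \<le> 0 + e" if e: "e > 0" for e
  proof -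
    let ?S = "ball a0 r \<times> ball b0 r"
    have S: "(a0, b0) \<in> ?S"
      using \<open>r > 0\<close> by simp
    obtain \<delta>1 where \<delta>1: "\<delta>1 > 0" "\<And>w. w \<in> ?S \<Longrightarrow> dist w (a0, b0) < \<delta>1 \<Longrightarrow>
        dist (\<phi>12 (fst w) (snd w)) (\<phi>12 a0 b0) < e / 2"
      using c12[unfolded continuous_on_iff, rule_format, OF S, of "e / 2"] e
      by (auto simp: case_prod_unfold)
    obtain \<delta>2 where \<delta>2: "\<delta>2 > 0" "\<And>w. w \<in> ?S \<Longrightarrow> dist w (a0, b0) < \<delta>2 \<Longrightarrow>
        dist (\<phi>21 (fst w) (snd w)) (\<phi>21 a0 b0) < e / 2"
      using c21[unfolded continuous_on_iff, rule_format, OF S, of "e / 2"] e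
      by (auto simp: case_prod_unfold)
    define h where "h = min r (min \<delta>1 \<delta>2) / 3"
    have h: "h > 0" "h < r" "2 * h < \<delta>1" "2 * h < \<delta>2"
      using \<delta>1 \<delta>2 \<open>r > 0\<close> by (auto simp: h_def)
    have box: "a \<in> ball a0 r" "b \<in> ball b0 r" "dist (a, b) (a0, b0) < \<delta>1" "dist (a, b) (a0, b0) < \<delta>2"
      if "a0 \<le> a" "a \<le> a0 + h" "b0 \<le> b" "b \<le> b0 + h" for a b
    proof -
      have "dist (a, b) (a0, b0) \<le> \<bar>a - a0\<bar> + \<bar>b - b0\<bar>"
        unfolding dist_prod_def by (simp add: dist_real_def sqrt_sum_squares_le_sum_abs)
      then show "a \<in> ball a0 r" "b \<in> ball b0 r" "dist (a, b) (a0, b0) < \<delta>1" "dist (a, b) (a0, b0) < \<delta>2"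
        using that h by (auto simp: dist_real_def)
    qed
    define D where "D = \<phi> (a0 + h) (b0 + h) - \<phi> (a0 + h) b0 - \<phi> a0 (b0 + h) + \<phi> a0 b0"
    \<comment> \<open>First in the first variable, then in the second.\<close>
    have "\<exists>\<xi>>a0. \<xi> < a0 + h \<and> (\<phi> (a0 + h) (b0 + h) - \<phi> (a0 + h) b0) - (\<phi> a0 (b0 + h) - \<phi> a0 b0)
        = (a0 + h - a0) * (\<phi>1 \<xi> (b0 + h) - \<phi>1 \<xi> b0)"
      using h by (intro MVT2[where f = "\<lambda>x. \<phi> x (b0 + h) - \<phi> x b0"])
        (auto intro!: DERIV_diff d1 box)
    then obtain \<xi> where \<xi>: "a0 < \<xi>" "\<xi> < a0 + h" "D = h * (\<phi>1 \<xi> (b0 + h) - \<phi>1 \<xi> b0)"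
      by (auto simp: D_def)
    have "\<exists>\<eta>>b0. \<eta> < b0 + h \<and> \<phi>1 \<xi> (b0 + h) - \<phi>1 \<xi> b0 = (b0 + h - b0) * \<phi>12 \<xi> \<eta>"
      using h \<xi> by (intro MVT2) (auto intro!: d12 box)
    then obtain \<eta> where \<eta>: "b0 < \<eta>" "\<eta> < b0 + h" "D = h * (h * \<phi>12 \<xi> \<eta>)"
      using \<xi> by auto
    \<comment> \<open>The opposite order.\<close>
    have "\<exists>\<eta>'>b0. \<eta>' < b0 + h \<and> (\<phi> (a0 + h) (b0 + h) - \<phi> a0 (b0 + h)) - (\<phi> (a0 + h) b0 - \<phi> a0 b0)
        = (b0 + h - b0) * (\<phi>2 (a0 + h) \<eta>' - \<phi>2 a0 \<eta>')"
      using h by (intro MVT2[where f = "\<lambda>x. \<phi> (a0 + h) x - \<phi> a0 x"])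
        (auto intro!: DERIV_diff d2 box)
    then obtain \<eta>' where \<eta>': "b0 < \<eta>'" "\<eta>' < b0 + h" "D = h * (\<phi>2 (a0 + h) \<eta>' - \<phi>2 a0 \<eta>')"
      by (auto simp: D_def algebra_simps)
    have "\<exists>\<xi>'>a0. \<xi>' < a0 + h \<and> \<phi>2 (a0 + h) \<eta>' - \<phi>2 a0 \<eta>' = (a0 + h - a0) * \<phi>21 \<xi>' \<eta>'"
      using h \<eta>' by (intro MVT2) (auto intro!: d21 box)
    then obtain \<xi>' where \<xi>': "a0 < \<xi>'" "\<xi>' < a0 + h" "D = h * (h * \<phi>21 \<xi>' \<eta>')"
      using \<eta>' by auto
    have eq: "\<phi>12 \<xi> \<eta> = \<phi>21 \<xi>' \<eta>'"
      using \<eta>(3) \<xi>'(3) h by simp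
    have "dist (\<phi>12 \<xi> \<eta>) (\<phi>12 a0 b0) < e / 2"
      using \<delta>1(2)[of "(\<xi>, \<eta>)"] box[of \<xi> \<eta>] \<xi> \<eta> by simp
    moreover have "dist (\<phi>21 \<xi>' \<eta>') (\<phi>21 a0 b0) < e / 2"
      using \<delta>2(2)[of "(\<xi>', \<eta>')"] box[of \<xi>' \<eta>'] \<xi>' \<eta>' by simp
    ultimately show ?thesis
      using eq by (simp add: dist_real_def abs_if split: if_splits)
  qed
  then have "\<bar>\<phi>12 a0 b0 - \<phi>21 a0 b0\<bar> \<le> 0"
    by (rule field_le_epsilon)
  then show ?thesis by simp
qed

text \<open>
  The claim is about one component \<open>i\<close> of \<open>g\<close> and one coordinate direction \<open>j\<close> of \<open>y\<close>, and for those it is the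
  symmetry of the mixed derivatives of the scalar function \<open>(a, s) \<mapsto> g\<^sub>i(y + a e\<^sub>j, z, s)\<close>.
\<close>
lemma jac_y_der_t_commute:
  fixes g :: "real^'n \<Rightarrow> real^'m \<Rightarrow> real \<Rightarrow> real^'k"
  assumes U: "openin (top_of_set (UNIV \<times> UNIV \<times> {0..T})) U"
    and g: "C1_in_yzt T U g" and gy: "C1_in_yzt T U (grad_y g i)" and gt: "C1_in_yzt T U (der_t T g)"
    and p: "(y, z, t) \<in> U" and t: "0 < t" "t < T"
  shows "jac_y (der_t T g) y z t $ i = der_t T (grad_y g i) y z t"
proof -
  have "jac_y (der_t T g) y z t $ i $ j = der_t T (grad_y g i) y z t $ j" for j
  proof -
    obtain r where r: "r > 0" "ball t r \<subseteq> {0<..<T}"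
      "\<forall>u\<in>ball y r. \<forall>v\<in>ball z r. \<forall>s\<in>ball t r. (u, v, s) \<in> U"
      using openin_time_slab_nbhd_interior[OF U p t] by metis
    define c where "c a = y + a *\<^sub>R axis j 1" for a :: real
    have cU: "(c a, z, s) \<in> U" "0 < s" "s < T" if "a \<in> ball 0 r" "s \<in> ball t r" for a s
      using that r by (auto simp: c_def dist_norm intro!: r(3)[rule_format])
    have cont: "continuous_on (ball 0 r \<times> ball t r) (\<lambda>w. c (fst w))"
      unfolding c_def by (intro continuous_intros)
    have dc: "(c has_vector_derivative axis j 1) (at a)" for a
      unfolding c_def by (auto intro!: derivative_eq_intros)
    have dy: "((\<lambda>x. F (c x) z s $ l) has_real_derivative jac_y F (c a) z s $ l $ j) (at a)"
      if "C1_in_yzt T U F" "(c a, z, s) \<in> U" for F :: "_ \<Rightarrow> _ \<Rightarrow> _ \<Rightarrow> real^'w" and a s l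
    proof -
      have "(((\<lambda>u. F u z s) \<circ> c) has_vector_derivative jac_y F (c a) z s *v axis j 1) (at a)"
        using vector_derivative_diff_chain_within[OF dc has_derivative_at_withinI[OF C1_in_yzD(1)[OF C1_in_yztD(1)[OF that(1)] that(2)]]] .
      from bounded_linear.has_vector_derivative[OF bounded_linear_vec_nth this, of l]
      show ?thesis
        by (simp add: o_def has_real_derivative_iff_has_vector_derivative matrix_vector_mult_basis column_def)
    qed
    have dt: "((\<lambda>x. F (c a) z x $ l) has_real_derivative der_t T F (c a) z s $ l) (at s)"
      if "C1_in_yzt T U F" "(c a, z, s) \<in> U" "0 < s" "s < T" for F :: "_ \<Rightarrow> _ \<Rightarrow> _ \<Rightarrow> real^'w" and a s l
      using bounded_linear.has_vector_derivative[OF bounded_linear_vec_nth C1_in_yztD(2)[OF that], of l]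
      by (simp add: has_real_derivative_iff_has_vector_derivative)
    have "der_t T (grad_y g i) (c 0) z t $ j = jac_y (der_t T g) (c 0) z t $ i $ j"
    proof (rule mixed_partials_commute[where \<phi> = "\<lambda>a s. g (c a) z s $ i" and r = r
          and ?\<phi>1.0 = "\<lambda>a s. grad_y g i (c a) z s $ j" and ?\<phi>2.0 = "\<lambda>a s. der_t T g (c a) z s $ i"
          and ?\<phi>12.0 = "\<lambda>a s. der_t T (grad_y g i) (c a) z s $ j"
          and ?\<phi>21.0 = "\<lambda>a s. jac_y (der_t T g) (c a) z s $ i $ j"])
      fix a s :: real assume "a \<in> ball 0 r" "s \<in> ball t r"
      note as = cU[OF this]
      show "((\<lambda>x. g (c x) z s $ i) has_real_derivative grad_y g i (c a) z s $ j) (at a)"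
        unfolding grad_y_def using dy[OF g as(1)] .
      show "((\<lambda>x. g (c a) z x $ i) has_real_derivative der_t T g (c a) z s $ i) (at s)"
        using dt[OF g as] .
      show "((\<lambda>x. grad_y g i (c a) z x $ j) has_real_derivative der_t T (grad_y g i) (c a) z s $ j) (at s)"
        using dt[OF gy as] .
      show "((\<lambda>x. der_t T g (c x) z s $ i) has_real_derivative jac_y (der_t T g) (c a) z s $ i $ j) (at a)"
        using dy[OF gt as(1)] .
    next
      have "continuous_on U (\<lambda>(y, z, t). der_t T (grad_y g i) y z t)"
        "continuous_on U (\<lambda>(y, z, t). jac_y (der_t T g) y z t)"
        using gy gt by (auto simp: C1_in_yzt_def C1_in_yz_def)
      then have "continuous_on (ball 0 r \<times> ball t r) (\<lambda>w. der_t T (grad_y g i) (c (fst w)) z (snd w))"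
        "continuous_on (ball 0 r \<times> ball t r) (\<lambda>w. jac_y (der_t T g) (c (fst w)) z (snd w))"
        by (auto intro!: continuous_on_along_curve[where p = "\<lambda>w. c (fst w)" and q = "\<lambda>_. z" and \<tau> = snd]
            cont continuous_intros cU)
      then show "continuous_on (ball 0 r \<times> ball t r) (\<lambda>(a, s). der_t T (grad_y g i) (c a) z s $ j)"
        "continuous_on (ball 0 r \<times> ball t r) (\<lambda>(a, s). jac_y (der_t T g) (c a) z s $ i $ j)"
        by (auto simp: case_prod_unfold intro!: continuous_intros)
    qed (rule r)
    then show ?thesis
      by (simp add: c_def)
  qed
  then show ?thesis
    by (simp add: vec_eq_iff)
qed

section \<open>Index reduction\<close>

text \<open>
  Only points of \<open>U\<close> are compared, and the section of \<open>U\<close> over \<open>(y, t)\<close> may be disconnected; this is the way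
  in which the index-2 condition says that \<open>g\<close> is a function of \<open>(y, t)\<close>.
\<close>
definition z_independent :: "((real^'n) \<times> (real^'m) \<times> real) set \<Rightarrow> (real^'n \<Rightarrow> real^'m \<Rightarrow> real \<Rightarrow> real^'k) \<Rightarrow> bool"
  where "z_independent U F \<longleftrightarrow> (\<forall>y z z' t. (y, z, t) \<in> U \<and> (y, z', t) \<in> U \<longrightarrow> F y z t = F y z' t)"

lemma z_independent_jac_z:
  assumes U: "openin (top_of_set (UNIV \<times> UNIV \<times> {0..T})) U" and F: "z_independent U F"
    and p: "(y, z, t) \<in> U"
  shows "jac_z F y z t = 0"
proof -
  obtain r where r: "r > 0" "t \<in> {0..T}"
    "\<forall>u\<in>ball y r. \<forall>v\<in>ball z r. \<forall>s\<in>ball t r \<inter> {0..T}. (u, v, s) \<in> U"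
    using openin_time_slab_nbhd[OF U p] by metis
  have "F y z t = F y v t" if "v \<in> ball z r" for v
    using F p r that unfolding z_independent_def by (metis IntI centre_in_ball)
  then have "((\<lambda>v. F y v t) has_derivative (\<lambda>_. 0)) (at z)"
    using r(1) by (intro has_derivative_transform_within_open[OF has_derivative_const, where s = "ball z r"]) auto
  then have "jac_z F y z t = matrix (\<lambda>_. 0)"
    by (simp add: jac_z_def jacobian_def frechet_derivative_at[symmetric])
  then show ?thesis
    by (simp add: matrix_def vec_eq_iff)
qed

text \<open>
  Both points of \<open>U\<close> have a neighborhood in \<open>U\<close>, so the two functions of \<open>y\<close> agree near \<open>y\<close> and have the same
  derivatives: the choice operator that selects the derivative is applied to the same predicate for both.
\<close>
lemma z_independent_grad_y:
  assumes U: "openin (top_of_set (UNIV \<times> UNIV \<times> {0..T})) U" and F: "z_independent U F"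
  shows "z_independent U (grad_y F i)"
  unfolding z_independent_def
proof (intro allI impI, elim conjE)
  fix y z z' t assume p: "(y, z, t) \<in> U" and p': "(y, z', t) \<in> U"
  obtain r where r: "r > 0" "t \<in> {0..T}"
    "\<forall>u\<in>ball y r. \<forall>v\<in>ball z r. \<forall>s\<in>ball t r \<inter> {0..T}. (u, v, s) \<in> U"
    using openin_time_slab_nbhd[OF U p] by metis
  obtain r' where r': "r' > 0" "t \<in> {0..T}"
    "\<forall>u\<in>ball y r'. \<forall>v\<in>ball z' r'. \<forall>s\<in>ball t r' \<inter> {0..T}. (u, v, s) \<in> U"
    using openin_time_slab_nbhd[OF U p'] by metis
  have eq: "F u z t = F u z' t" if "u \<in> ball y (min r r')" for u
  proof -
    have "(u, z, t) \<in> U" "(u, z', t) \<in> U"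
      using r r' that by auto
    then show ?thesis
      using F unfolding z_independent_def by blast
  qed
  have b: "open (ball y (min r r'))" "y \<in> ball y (min r r')"
    using r(1) r'(1) by auto
  have "((\<lambda>u. F u z t) has_derivative D) (at y) \<longleftrightarrow> ((\<lambda>u. F u z' t) has_derivative D) (at y)" for D
    using has_derivative_transform_within_open[OF _ b, of "\<lambda>u. F u z t" D UNIV "\<lambda>u. F u z' t"]
      has_derivative_transform_within_open[OF _ b, of "\<lambda>u. F u z' t" D UNIV "\<lambda>u. F u z t"] eq
    by auto
  then show "grad_y F i y z t = grad_y F i y z' t"
    by (simp add: grad_y_def jac_y_def jacobian_def frechet_derivative_def)
qed

lemma z_independent_der_t:
  assumes U: "openin (top_of_set (UNIV \<times> UNIV \<times> {0..T})) U" and F: "z_independent U F"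
  shows "z_independent U (der_t T F)"
  unfolding z_independent_def
proof (intro allI impI, elim conjE)
  fix y z z' t assume p: "(y, z, t) \<in> U" and p': "(y, z', t) \<in> U"
  obtain r where r: "r > 0" "t \<in> {0..T}"
    "\<forall>u\<in>ball y r. \<forall>v\<in>ball z r. \<forall>s\<in>ball t r \<inter> {0..T}. (u, v, s) \<in> U"
    using openin_time_slab_nbhd[OF U p] by metis
  obtain r' where r': "r' > 0" "t \<in> {0..T}"
    "\<forall>u\<in>ball y r'. \<forall>v\<in>ball z' r'. \<forall>s\<in>ball t r' \<inter> {0..T}. (u, v, s) \<in> U"
    using openin_time_slab_nbhd[OF U p'] by metis
  have eq: "F y z s = F y z' s" if "s \<in> {0..T}" "dist s t < min r r'" for s
  proof -
    have "(y, z, s) \<in> U" "(y, z', s) \<in> U"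
      using r r' that by (auto simp: dist_commute)
    then show ?thesis
      using F unfolding z_independent_def by blast
  qed
  have b: "0 < min r r'"
    using r(1) r'(1) by auto
  have "((\<lambda>s. F y z s) has_vector_derivative D) (at t within {0..T}) \<longleftrightarrow>
      ((\<lambda>s. F y z' s) has_vector_derivative D) (at t within {0..T})" for D
    using has_vector_derivative_transform_within[OF _ b r(2), of "\<lambda>s. F y z s" D "\<lambda>s. F y z' s"]
      has_vector_derivative_transform_within[OF _ b r(2), of "\<lambda>s. F y z' s" D "\<lambda>s. F y z s"] eq
    by auto
  then show "der_t T F y z t = der_t T F y z' t"
    by (simp add: der_t_def vector_derivative_def)
qed

lemma matrix_inv_vector_solve:
  fixes A :: "real^'n^'n"
  assumes "invertible A" and "A *v x + b = 0"
  shows "x = - (matrix_inv A *v b)"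
proof -
  have "matrix_inv A ** A = mat 1"
    using assms(1) unfolding invertible_def matrix_inv_def by (metis (mono_tags, lifting) someI_ex)
  then have "x = matrix_inv A *v (A *v x)"
    by (simp add: matrix_vector_mul_assoc)
  also have "A *v x = - b"
    using assms(2) by (simp add: eq_neg_iff_add_eq_0)
  finally show ?thesis
    by (simp add: linear_neg[OF matrix_vector_mul_linear])
qed

lemma constraint_derivative:
  assumes U: "openin (top_of_set (UNIV \<times> UNIV \<times> {0..T})) U" and C1: "C1_in_yzt T U F"
    and p: "(y t, z t, t) \<in> U" and t: "0 < t" "t < T"
    and y: "(y has_vector_derivative y') (at t)" and z: "(z has_vector_derivative z') (at t)"
    and zero: "\<And>s. 0 < s \<Longrightarrow> s < T \<Longrightarrow> F (y s) (z s) s = 0"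
  shows "jac_y F (y t) (z t) t *v y' + jac_z F (y t) (z t) t *v z' + der_t T F (y t) (z t) t = 0"
proof -
  have "((\<lambda>s. F (y s) (z s) s) has_vector_derivative 0) (at t)"
    using zero t
    by (intro has_vector_derivative_transform_within_open[OF has_vector_derivative_const, where S = "{0<..<T}"]) auto
  then show ?thesis
    using C1_in_yzt_chain_rule[OF U C1 p t y z] vector_derivative_unique_at by blast
qed

text \<open>
  Differentiating \<open>g(y, t) = 0\<close> once gives \<open>g\<^sub>y f + g\<^sub>t = 0\<close>. This identity is differentiated a second time,
  one component at a time: the \<open>i\<close>-th component of \<open>g\<^sub>y f\<close> is the inner product of \<open>grad_y g i\<close> with \<open>f\<close>, so
  only derivatives of vector-valued functions occur. The variable \<open>z'\<close> enters through \<open>f\<close> alone, since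
  \<open>grad_y g i\<close> and \<open>der_t T g\<close> do not depend on \<open>z\<close>. The symmetry of the mixed derivatives merges the
  derivative of \<open>g\<^sub>y\<close> in \<open>t\<close> and that of \<open>g\<^sub>t\<close> in \<open>y\<close> into the term with factor 2.
\<close>
lemma hidden_constraint:
  assumes U: "openin (top_of_set (UNIV \<times> UNIV \<times> {0..T})) U"
    and f: "C1_in_yzt T U f" and g: "C1_in_yzt T U g"
    and gy: "\<And>i. C1_in_yzt T U (grad_y g i)" and gt: "C1_in_yzt T U (der_t T g)"
    and gz: "z_independent U g"
    and curve: "\<And>s. 0 < s \<Longrightarrow> s < T \<Longrightarrow> (y s, z s, s) \<in> U"
    and y: "\<And>s. 0 < s \<Longrightarrow> s < T \<Longrightarrow> (y has_vector_derivative f (y s) (z s) s) (at s)"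
    and z: "\<And>s. 0 < s \<Longrightarrow> s < T \<Longrightarrow> (z has_vector_derivative z' s) (at s)"
    and zero: "\<And>s. 0 < s \<Longrightarrow> s < T \<Longrightarrow> g (y s) (z s) s = 0"
    and t: "0 < t" "t < T"
  shows "(jac_y g (y t) (z t) t ** jac_z f (y t) (z t) t) *v z' t +
      (g_yy_quadratic f g (y t) (z t) t
       + jac_y g (y t) (z t) t *v (jac_y f (y t) (z t) t *v f (y t) (z t) t)
       + 2 *\<^sub>R (g_yt_matrix T g (y t) (z t) t *v f (y t) (z t) t)
       + jac_y g (y t) (z t) t *v der_t T f (y t) (z t) t
       + der_t T (der_t T g) (y t) (z t) t) = 0"
    (is "?A *v z' t + (?Q + ?B + 2 *\<^sub>R ?C + ?D + ?E) = 0")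
proof -
  let ?at = "\<lambda>F. F (y t) (z t) t"
  note p = curve[OF t]
  have first: "jac_y g (y s) (z s) s *v f (y s) (z s) s + der_t T g (y s) (z s) s = 0" if "0 < s" "s < T" for s
    using constraint_derivative[OF U g curve[OF that] that y[OF that] z[OF that] zero]
      z_independent_jac_z[OF U gz curve[OF that]] by simp
  have "(?A *v z' t + (?Q + ?B + 2 *\<^sub>R ?C + ?D + ?E)) $ i = 0" for i
  proof -
    let ?G = "\<lambda>s. grad_y g i (y s) (z s) s \<bullet> f (y s) (z s) s + der_t T g (y s) (z s) s $ i"
    have G0: "?G s = 0" if "0 < s" "s < T" for s
      using arg_cong[OF first[OF that], of "\<lambda>v. v $ i"] by (simp add: grad_y_def matrix_vector_mul_component)
    have zi: "jac_z (grad_y g i) (y t) (z t) t = 0" "jac_z (der_t T g) (y t) (z t) t = 0"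
      using z_independent_jac_z[OF U _ p] z_independent_grad_y[OF U gz] z_independent_der_t[OF U gz] by blast+
    have d1: "((\<lambda>s. grad_y g i (y s) (z s) s) has_vector_derivative
        ?at (jac_y (grad_y g i)) *v ?at f + ?at (der_t T (grad_y g i))) (at t)"
      using C1_in_yzt_chain_rule[OF U gy p t y[OF t] z[OF t], of i] zi by simp
    have d2: "((\<lambda>s. f (y s) (z s) s) has_vector_derivative
        ?at (jac_y f) *v ?at f + ?at (jac_z f) *v z' t + ?at (der_t T f)) (at t)"
      using C1_in_yzt_chain_rule[OF U f p t y[OF t] z[OF t]] .
    have d3: "((\<lambda>s. der_t T g (y s) (z s) s $ i) has_vector_derivative
        (?at (jac_y (der_t T g)) *v ?at f + ?at (der_t T (der_t T g))) $ i) (at t)"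
      using bounded_linear.has_vector_derivative[OF bounded_linear_vec_nth
          C1_in_yzt_chain_rule[OF U gt p t y[OF t] z[OF t]], of i] zi by simp
    have "(?G has_vector_derivative
       (?at (grad_y g i) \<bullet> (?at (jac_y f) *v ?at f + ?at (jac_z f) *v z' t + ?at (der_t T f))
        + (?at (jac_y (grad_y g i)) *v ?at f + ?at (der_t T (grad_y g i))) \<bullet> ?at f)
        + (?at (jac_y (der_t T g)) *v ?at f + ?at (der_t T (der_t T g))) $ i) (at t)"
      by (intro has_vector_derivative_add bounded_bilinear.has_vector_derivative[OF bounded_bilinear_inner] d1 d2 d3)
    moreover have "(?G has_vector_derivative 0) (at t)"
      using G0 t
      by (intro has_vector_derivative_transform_within_open[OF has_vector_derivative_const, where S = "{0<..<T}"]) auto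
    ultimately have "(?at (grad_y g i) \<bullet> (?at (jac_y f) *v ?at f + ?at (jac_z f) *v z' t + ?at (der_t T f))
        + (?at (jac_y (grad_y g i)) *v ?at f + ?at (der_t T (grad_y g i))) \<bullet> ?at f)
        + (?at (jac_y (der_t T g)) *v ?at f + ?at (der_t T (der_t T g))) $ i = 0"
      by (rule vector_derivative_unique_at)
    moreover have "(?at (jac_y (grad_y g i)) *v ?at f) \<bullet> ?at f = ?Q $ i"
    proof -
      have "(?at (jac_y (grad_y g i)) *v ?at f) \<bullet> ?at f =
          (\<Sum>k\<in>UNIV. \<Sum>j\<in>UNIV. ?at (jac_y (grad_y g i)) $ k $ j * ?at f $ j * ?at f $ k)"
        by (simp add: inner_vec_def matrix_vector_mult_def sum_distrib_right)
      also have "\<dots> = ?Q $ i"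
        unfolding g_yy_quadratic_def by (simp, rule sum.swap)
      finally show ?thesis .
    qed
    moreover have "?at (der_t T (grad_y g i)) \<bullet> ?at f = ?C $ i"
      by (simp add: g_yt_matrix_def matrix_vector_mul_component)
    moreover have "(?at (jac_y (der_t T g)) *v ?at f) $ i = ?C $ i"
      by (simp add: g_yt_matrix_def matrix_vector_mul_component jac_y_der_t_commute[OF U g gy gt p t])
    ultimately show ?thesis
      by (simp add: grad_y_def matrix_vector_mul_component inner_add_left inner_add_right
          matrix_vector_mul_assoc[symmetric])
  qed
  then show ?thesis
    unfolding vec_eq_iff by simp
qed

text \<open>
  In both cases a differentiated constraint is a linear equation for \<open>z'\<close> whose matrix is invertible by
  the index condition, and \<open>reduced_rhs\<close> is its solution. The interior of the time interval is enough for
  the error formula, and there the derivatives within \<open>{0..T}\<close> are ordinary two-sided derivatives.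
\<close>
lemma dae_solution_solves_reduced_ode:
  assumes U: "openin (top_of_set (UNIV \<times> UNIV \<times> {0..T})) U"
    and sol: "dae_solution T f g y z"
    and curve: "\<And>s. 0 \<le> s \<Longrightarrow> s \<le> T \<Longrightarrow> (y s, z s, s) \<in> U"
    and smooth: "smooth_data idx T U f g" and index: "has_index idx U f g"
    and t: "0 < t" "t < T"
  shows "(z has_vector_derivative reduced_rhs idx T f g (y t) (z t) t) (at t)"
proof -
  define z' where "z' s = vector_derivative z (at s)" for s
  have at: "at s within {0..T} = at s" if "0 < s" "s < T" for s
    using that by (intro at_within_interior) auto
  have y: "(y has_vector_derivative f (y s) (z s) s) (at s)" if "0 < s" "s < T" for s
    using sol that at[OF that] unfolding dae_solution_def by (metis atLeastAtMost_iff less_eq_real_def)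
  have z: "(z has_vector_derivative z' s) (at s)" if "0 < s" "s < T" for s
    using sol that at[OF that] unfolding z'_def vector_derivative_works[symmetric] dae_solution_def
    by (metis atLeastAtMost_iff less_eq_real_def)
  have zero: "g (y s) (z s) s = 0" if "0 < s" "s < T" for s
    using sol that by (auto simp: dae_solution_def)
  have p: "(y t, z t, t) \<in> U"
    using curve t by simp
  have "z' t = reduced_rhs idx T f g (y t) (z t) t"
  proof (cases idx)
    case Semi_Explicit_Index1
    then have g: "C1_in_yzt T U g" and inv: "invertible (jac_z g (y t) (z t) t)"
      using smooth index p by auto
    show ?thesis
      using matrix_inv_vector_solve[OF inv, of "z' t"] constraint_derivative[OF U g p t y[OF t] z[OF t] zero]
      by (simp add: Semi_Explicit_Index1 ac_simps)
  next
    case Hessenberg_Index2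
    then have "C1_in_yzt T U f" "C1_in_yzt T U g" "\<And>i. C1_in_yzt T U (grad_y g i)" "C1_in_yzt T U (der_t T g)"
      "z_independent U g" and inv: "invertible (jac_y g (y t) (z t) t ** jac_z f (y t) (z t) t)"
      using smooth index p by (auto simp: z_independent_def)
    from matrix_inv_vector_solve[OF inv hidden_constraint[OF U this(1-5) _ y z zero t]] curve
    show ?thesis
      by (simp add: Hessenberg_Index2)
  qed
  then show ?thesis
    using z[OF t] by simp
qed

section \<open>Piecewise linear interpolants\<close>

text \<open>
  The formula of a piece is also valid at its right node, although the floor function there already
  selects the next piece: both give the value \<open>a (k + 1)\<close>.
\<close>
lemma pw_linear_on_piece:
  assumes "\<Delta> > 0" and "real k * \<Delta> \<le> t" "t \<le> real (Suc k) * \<Delta>"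
  shows "pw_linear \<Delta> a t = a k + (t / \<Delta> - real k) *\<^sub>R (a (Suc k) - a k)"
proof (cases "t = real (Suc k) * \<Delta>")
  case True
  then have "t / \<Delta> = real (Suc k)"
    using assms by simp
  moreover have "nat \<lfloor>real (Suc k)\<rfloor> = Suc k"
    by (metis floor_of_nat nat_int)
  ultimately show ?thesis
    unfolding pw_linear_def by (simp add: Let_def)
next
  case False
  then have "real k \<le> t / \<Delta>" "t / \<Delta> < real k + 1"
    using assms by (auto simp: pos_le_divide_eq pos_divide_less_eq algebra_simps)
  then have "\<lfloor>t / \<Delta>\<rfloor> = int k"
    by (simp add: floor_eq_iff)
  then show ?thesis
    unfolding pw_linear_def by simp
qed

lemma pw_linear_piece_exists:
  assumes "\<Delta> > 0" "0 \<le> t" "t \<le> real N * \<Delta>" "N > 0"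
  obtains k where "k < N" "real k * \<Delta> \<le> t" "t \<le> real (Suc k) * \<Delta>"
proof (cases "t = real N * \<Delta>")
  case True
  then show thesis
    using assms by (intro that[of "N - 1"]) (auto simp: of_nat_diff algebra_simps)
next
  case False
  define k where "k = nat \<lfloor>t / \<Delta>\<rfloor>"
  have "real k = \<lfloor>t / \<Delta>\<rfloor>"
    using assms by (simp add: k_def)
  then have k: "real k \<le> t / \<Delta>" "t / \<Delta> < real k + 1"
    by linarith+
  have "t / \<Delta> < real N"
    using assms False by (simp add: pos_divide_less_eq)
  then have "k < N"
    using k by linarith
  then show thesis
    using k assms by (intro that[of k]) (auto simp: pos_le_divide_eq pos_divide_less_eq algebra_simps)
qed

lemma pw_linear_has_vector_derivative:
  fixes a :: "nat \<Rightarrow> 'a::real_normed_vector"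
  assumes "\<Delta> > 0" and t: "real k * \<Delta> < t" "t < real (Suc k) * \<Delta>"
  shows "(pw_linear \<Delta> a has_vector_derivative (1 / \<Delta>) *\<^sub>R (a (Suc k) - a k)) (at t)"
proof -
  have "((\<lambda>t. a k + (t / \<Delta> - real k) *\<^sub>R (a (Suc k) - a k)) has_vector_derivative
      (1 / \<Delta>) *\<^sub>R (a (Suc k) - a k)) (at t)"
    using \<open>\<Delta> > 0\<close> by (auto intro!: derivative_eq_intros simp: divide_inverse)
  then show ?thesis
    by (rule has_vector_derivative_transform_within_open[where S = "{real k * \<Delta><..<real (Suc k) * \<Delta>}"])
      (use assms pw_linear_on_piece[OF \<open>\<Delta> > 0\<close>, of k _ a] in auto)
qed

lemma pw_linear_lipschitz:
  fixes a :: "nat \<Rightarrow> 'a::real_normed_vector"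
  assumes "\<Delta> > 0" "N > 0"
  obtains L where "L-lipschitz_on {0..real N * \<Delta>} (pw_linear \<Delta> a)"
proof -
  \<comment> \<open>The sum of all slopes bounds each of them.\<close>
  define M where "M = (\<Sum>k<N. norm (a (Suc k) - a k)) / \<Delta>"
  have "M-lipschitz_on {0..real N * \<Delta>} (pw_linear \<Delta> a)"
  proof (rule lipschitz_on_closed_Union[where I = "{..<N}" and U = "\<lambda>k. {real k * \<Delta>..real (Suc k) * \<Delta>}"])
    show M: "0 \<le> M"
      using assms by (simp add: M_def sum_nonneg)
    show "M-lipschitz_on {real k * \<Delta>..real (Suc k) * \<Delta>} (pw_linear \<Delta> a)" if "k \<in> {..<N}" for k
    proof (rule lipschitz_onI[OF _ M])
      fix s t assume st: "s \<in> {real k * \<Delta>..real (Suc k) * \<Delta>}" "t \<in> {real k * \<Delta>..real (Suc k) * \<Delta>}"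
      have "pw_linear \<Delta> a s - pw_linear \<Delta> a t = ((s - t) / \<Delta>) *\<^sub>R (a (Suc k) - a k)"
        using st by (simp add: pw_linear_on_piece[OF \<open>\<Delta> > 0\<close>, of k] scaleR_left_diff_distrib[symmetric]
            diff_divide_distrib del: of_nat_Suc)
      then have "dist (pw_linear \<Delta> a s) (pw_linear \<Delta> a t) = (norm (a (Suc k) - a k) / \<Delta>) * dist s t"
        using assms by (simp add: dist_norm)
      also have "\<dots> \<le> M * dist s t"
        unfolding M_def using that assms member_le_sum[of k "{..<N}" "\<lambda>k. norm (a (Suc k) - a k)"]
        by (intro mult_right_mono divide_right_mono) auto
      finally show "dist (pw_linear \<Delta> a s) (pw_linear \<Delta> a t) \<le> M * dist s t" .
    qed
    show "{0..real N * \<Delta>} \<subseteq> (\<Union>k\<in>{..<N}. {real k * \<Delta>..real (Suc k) * \<Delta>})"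
    proof
      fix t assume "t \<in> {0..real N * \<Delta>}"
      then obtain k where "k < N" "real k * \<Delta> \<le> t" "t \<le> real (Suc k) * \<Delta>"
        using pw_linear_piece_exists[OF assms(1) _ _ assms(2)] by (metis atLeastAtMost_iff)
      then show "t \<in> (\<Union>k\<in>{..<N}. {real k * \<Delta>..real (Suc k) * \<Delta>})"
        by auto
    qed
  qed auto
  then show thesis
    by (rule that)
qed

lemma pw_linear_derivative_off_nodes:
  fixes a :: "nat \<Rightarrow> 'a::real_normed_vector"
  assumes "\<Delta> > 0" "N > 0" and t: "t \<in> {0..real N * \<Delta>} - (\<lambda>k. real k * \<Delta>) ` {..N}"
  shows "(pw_linear \<Delta> a has_vector_derivative vector_derivative (pw_linear \<Delta> a) (at t)) (at t)"
proof -
  obtain k where k: "k < N" "real k * \<Delta> \<le> t" "t \<le> real (Suc k) * \<Delta>"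
    using pw_linear_piece_exists[OF assms(1) _ _ assms(2)] t by (metis Diff_iff atLeastAtMost_iff)
  have "t \<noteq> real k * \<Delta>" "t \<noteq> real (Suc k) * \<Delta>"
    using t k(1) by (auto simp del: of_nat_Suc)
  then have "(pw_linear \<Delta> a has_vector_derivative (1 / \<Delta>) *\<^sub>R (a (Suc k) - a k)) (at t)"
    using k by (intro pw_linear_has_vector_derivative[OF \<open>\<Delta> > 0\<close>]) auto
  then show ?thesis
    using vector_derivative_at by metis
qed

text \<open>
  The interpolant has a constant slope on each open piece, so the integrand agrees with a continuous
  function on each closed piece except at its two nodes, where the derivative has an arbitrary value.
\<close>
lemma integrable_inner_pw_linear_derivative:
  fixes a :: "nat \<Rightarrow> 'a::euclidean_space"
  assumes "\<Delta> > 0" and w: "continuous_on {0..real N * \<Delta>} w"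
  shows "(\<lambda>t. w t \<bullet> vector_derivative (pw_linear \<Delta> a) (at t)) integrable_on {0..real N * \<Delta>}"
    (is "?d integrable_on _")
proof -
  have "?d integrable_on {0..real n * \<Delta>}" if "n \<le> N" for n
    using that
  proof (induction n)
    case 0
    then show ?case
      using integrable_on_refl[of ?d 0] by simp
  next
    case (Suc n)
    have sub: "{real n * \<Delta>..real (Suc n) * \<Delta>} \<subseteq> {0..real N * \<Delta>}"
      using Suc.prems \<open>\<Delta> > 0\<close> by (auto intro: order_trans mult_right_mono simp del: of_nat_Suc)
    have "?d integrable_on {real n * \<Delta>..real (Suc n) * \<Delta>}"
    proof (rule integrable_spike_finite[where S = "{real n * \<Delta>, real (Suc n) * \<Delta>}"])
      show "(\<lambda>t. w t \<bullet> ((1 / \<Delta>) *\<^sub>R (a (Suc n) - a n))) integrable_on {real n * \<Delta>..real (Suc n) * \<Delta>}"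
        by (intro integrable_continuous_real continuous_intros continuous_on_subset[OF w sub])
      show "?d t = w t \<bullet> ((1 / \<Delta>) *\<^sub>R (a (Suc n) - a n))"
        if "t \<in> {real n * \<Delta>..real (Suc n) * \<Delta>} - {real n * \<Delta>, real (Suc n) * \<Delta>}" for t
        using vector_derivative_at[OF pw_linear_has_vector_derivative[OF \<open>\<Delta> > 0\<close>, of n t a]] that
        by auto
    qed auto
    moreover have "?d integrable_on {0..real n * \<Delta>}"
      using Suc by simp
    moreover have "0 \<le> real n * \<Delta>" "real n * \<Delta> \<le> real (Suc n) * \<Delta>"
      using \<open>\<Delta> > 0\<close> by auto
    ultimately show ?case
      using Henstock_Kurzweil_Integration.integrable_combine by blast
  qed
  then show ?thesis
    by blast
qed



section \<open>Error representation\<close>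

text \<open>
  With \<open>P = \<nu>y \<bullet> ey + \<nu>z \<bullet> ez\<close>, the four operators contribute to \<open>P'\<close> once through the error equation and
  once, transposed and with the opposite sign, through the adjoint equation. What remains of \<open>P'\<close> is the
  residual weighted with the adjoint solution, and \<open>P\<close> is absolutely continuous, so it is the integral of
  \<open>P'\<close>.
\<close>
lemma adjoint_error_representation:
  fixes ey :: "real \<Rightarrow> real^'n" and ez :: "real \<Rightarrow> real^'m"
  assumes "T > 0"
    and adj: "adjoint_solution T A B C D \<zeta>y \<zeta>z \<nu>y \<nu>z"
    and ey: "absolutely_continuous_fun 0 T ey" and ez: "absolutely_continuous_fun 0 T ez"
    and S: "negligible S"
    and ey': "\<And>t. t \<in> {0..T} - S \<Longrightarrow> (ey has_vector_derivative A t *v ey t + B t *v ez t + ry t) (at t)"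
    and ez': "\<And>t. t \<in> {0..T} - S \<Longrightarrow> (ez has_vector_derivative C t *v ey t + D t *v ez t + rz t) (at t)"
  shows "((\<lambda>t. \<nu>y t \<bullet> ry t + \<nu>z t \<bullet> rz t) has_integral
      (\<zeta>y \<bullet> ey T + \<zeta>z \<bullet> ez T) - (\<nu>y 0 \<bullet> ey 0 + \<nu>z 0 \<bullet> ez 0)) {0..T}"
proof -
  have \<nu>: "absolutely_continuous_fun 0 T \<nu>y" "absolutely_continuous_fun 0 T \<nu>z" "\<nu>y T = \<zeta>y" "\<nu>z T = \<zeta>z"
    and ae: "AE t in lebesgue. t \<in> {0..<T} \<longrightarrow>
       (\<nu>y has_vector_derivative - (transpose (A t) *v \<nu>y t + transpose (C t) *v \<nu>z t)) (at t) \<and>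
       (\<nu>z has_vector_derivative - (transpose (B t) *v \<nu>y t + transpose (D t) *v \<nu>z t)) (at t)"
    using adj by (simp_all add: adjoint_solution_def)
  obtain M where M: "M \<in> null_sets lebesgue"
    and M': "{t \<in> space lebesgue. \<not> (t \<in> {0..<T} \<longrightarrow>
       (\<nu>y has_vector_derivative - (transpose (A t) *v \<nu>y t + transpose (C t) *v \<nu>z t)) (at t) \<and>
       (\<nu>z has_vector_derivative - (transpose (B t) *v \<nu>y t + transpose (D t) *v \<nu>z t)) (at t))} \<subseteq> M"
    using ae unfolding eventually_ae_filter by (elim bexE)
  have \<nu>':
    "(\<nu>y has_vector_derivative - (transpose (A t) *v \<nu>y t + transpose (C t) *v \<nu>z t)) (at t)"
    "(\<nu>z has_vector_derivative - (transpose (B t) *v \<nu>y t + transpose (D t) *v \<nu>z t)) (at t)"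
    if "t \<notin> M" "t \<in> {0..<T}" for t
    using M' that by auto
  define P where "P t = \<nu>y t \<bullet> ey t + \<nu>z t \<bullet> ez t" for t
  have "((\<lambda>t. \<nu>y t \<bullet> ry t + \<nu>z t \<bullet> rz t) has_integral P T - P 0) {0..T}"
  proof (rule absolutely_continuous_fun_has_integral)
    show "absolutely_continuous_fun 0 T P"
      unfolding P_def by (intro absolutely_continuous_fun_add absolutely_continuous_fun_inner \<nu> ey ez)
    \<comment> \<open>The adjoint equation is posed on \<open>[0, T)\<close>, so the endpoint \<open>T\<close> joins the exceptional set.\<close>
    show "negligible (insert T (S \<union> M))"
      using S M by (simp add: negligible_iff_null_sets[symmetric])
    show "(P has_vector_derivative \<nu>y t \<bullet> ry t + \<nu>z t \<bullet> rz t) (at t within {0..T})"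
      if "t \<in> {0..T} - insert T (S \<union> M)" for t
    proof -
      have t: "t \<notin> M" "t \<in> {0..<T}" "t \<in> {0..T} - S"
        using that by auto
      have "(P has_vector_derivative
          (\<nu>y t \<bullet> (A t *v ey t + B t *v ez t + ry t)
           + - (transpose (A t) *v \<nu>y t + transpose (C t) *v \<nu>z t) \<bullet> ey t)
          + (\<nu>z t \<bullet> (C t *v ey t + D t *v ez t + rz t)
           + - (transpose (B t) *v \<nu>y t + transpose (D t) *v \<nu>z t) \<bullet> ez t)) (at t)"
        unfolding P_def
        by (intro has_vector_derivative_add bounded_bilinear.has_vector_derivative[OF bounded_bilinear_inner]
            \<nu>'[OF t(1,2)] ey'[OF t(3)] ez'[OF t(3)])
      then have "(P has_vector_derivative \<nu>y t \<bullet> ry t + \<nu>z t \<bullet> rz t) (at t)"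
        by (simp add: inner_add_left inner_add_right inner_diff_left dot_lmul_matrix)
      then show ?thesis
        by (rule has_vector_derivative_at_within)
    qed
  qed (use \<open>T > 0\<close> in simp)
  then show ?thesis
    by (simp add: P_def \<nu>)
qed

theorem theorem4p2:
  fixes T :: real and N :: nat and idx :: dae_index
    and U :: "((real^'n) \<times> (real^'m) \<times> real) set"
    and f :: "real^'n \<Rightarrow> real^'m \<Rightarrow> real \<Rightarrow> real^'n"
    and g h :: "real^'n \<Rightarrow> real^'m \<Rightarrow> real \<Rightarrow> real^'m"
    and y Y \<nu>y :: "real \<Rightarrow> real^'n" and z Z \<nu>z :: "real \<Rightarrow> real^'m"
    and Yk :: "nat \<Rightarrow> real^'n" and Zk :: "nat \<Rightarrow> real^'m"
    and \<zeta>y :: "real^'n" and \<zeta>z :: "real^'m"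
  assumes "T > 0" and "N > 0"
    and "dae_solution T f g y z"
    and "bdf1_solution T N f g (y 0) (z 0) Yk Zk"
    and "Y = pw_linear (T / real N) Yk" and "Z = pw_linear (T / real N) Zk"
    and "openin (top_of_set (UNIV \<times> UNIV \<times> {0..T})) U"
    and "\<forall>t\<in>{0..T}. \<forall>s\<in>{0..1}.
           (s *\<^sub>R y t + (1 - s) *\<^sub>R Y t, s *\<^sub>R z t + (1 - s) *\<^sub>R Z t, t) \<in> U"
    and "smooth_data idx T U f g"
    and "has_index idx U f g"
    and "h = reduced_rhs idx T f g"
    and "C1_in_yz U h"
    and "adjoint_solution T
           (segment_average (jac_y f) y z Y Z) (segment_average (jac_z f) y z Y Z)
           (segment_average (jac_y h) y z Y Z) (segment_average (jac_z h) y z Y Z)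
           \<zeta>y \<zeta>z \<nu>y \<nu>z"
  shows "final_qoi T \<zeta>y \<zeta>z y z - final_qoi T \<zeta>y \<zeta>z Y Z
           = (y T - Y T) \<bullet> \<zeta>y + (z T - Z T) \<bullet> \<zeta>z
         \<and> final_qoi T \<zeta>y \<zeta>z y z - final_qoi T \<zeta>y \<zeta>z Y Z
           = \<nu>y 0 \<bullet> (y 0 - Y 0) + \<nu>z 0 \<bullet> (z 0 - Z 0)
             + inner_int T \<nu>y (\<lambda>t. f (Y t) (Z t) t - vector_derivative Y (at t))
             + inner_int T \<nu>z (\<lambda>t. h (Y t) (Z t) t - vector_derivative Z (at t))"
proof -
  note sol = assms(3) and U = assms(7) and h1 = assms(12) and adj = assms(13)
  define \<Delta> where "\<Delta> = T / real N"
  have \<Delta>: "\<Delta> > 0" "real N * \<Delta> = T"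
    using assms(1,2) by (auto simp: \<Delta>_def)
  have YZ: "Y = pw_linear \<Delta> Yk" "Z = pw_linear \<Delta> Zk"
    using assms(5,6) by (simp_all add: \<Delta>_def)
  have f1: "C1_in_yz U f"
    using assms(9) by (cases idx) (auto simp: C1_in_yzt_def)
  have seg: "(s *\<^sub>R y t + (1 - s) *\<^sub>R Y t, s *\<^sub>R z t + (1 - s) *\<^sub>R Z t, t) \<in> U"
    if "t \<in> {0..T}" "s \<in> {0..1}" for s t
    using assms(8) that by blast
  have exact: "(y t, z t, t) \<in> U" and approx: "(Y t, Z t, t) \<in> U" if "t \<in> {0..T}" for t
    using seg[OF that, of 1] seg[OF that, of 0] by simp_all
  have y': "(y has_vector_derivative f (y t) (z t) t) (at t)" if "0 < t" "t < T" for t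
    using sol that at_within_interior[of t "{0..T}"] unfolding dae_solution_def
    by (metis atLeastAtMost_iff greaterThanLessThan_iff interior_atLeastAtMost_real less_eq_real_def)
  have z': "(z has_vector_derivative h (y t) (z t) t) (at t)" if "0 < t" "t < T" for t
    unfolding assms(11) using dae_solution_solves_reduced_ode[OF U sol _ assms(9,10) that] exact by simp
  have cont: "continuous_on {0..T} y" "continuous_on {0..T} z"
    using sol unfolding dae_solution_def continuous_on_eq_continuous_within
    by (metis has_vector_derivative_continuous, metis differentiable_imp_continuous_within)
  have F: "continuous_on U (\<lambda>(y, z, t). f y z t)" "continuous_on U (\<lambda>(y, z, t). h y z t)"
    using f1 h1 by (simp_all add: C1_in_yz_def)
  have rhs: "continuous_on {0..T} (\<lambda>t. f (y t) (z t) t)" "continuous_on {0..T} (\<lambda>t. h (y t) (z t) t)"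
    by - (rule continuous_on_along_curve[OF F(1) cont continuous_on_id exact], assumption,
        rule continuous_on_along_curve[OF F(2) cont continuous_on_id exact], assumption)
  obtain Ly where Ly: "Ly-lipschitz_on {0..T} y"
    using lipschitz_on_of_bounded_interior_derivative[OF cont(1) rhs(1) y'] .
  obtain Lz where Lz: "Lz-lipschitz_on {0..T} z"
    using lipschitz_on_of_bounded_interior_derivative[OF cont(2) rhs(2) z'] .
  obtain LY where LY: "LY-lipschitz_on {0..T} Y"
    using pw_linear_lipschitz[OF \<Delta>(1) assms(2), of Yk] by (auto simp: \<Delta>(2) YZ)
  obtain LZ where LZ: "LZ-lipschitz_on {0..T} Z"
    using pw_linear_lipschitz[OF \<Delta>(1) assms(2), of Zk] by (auto simp: \<Delta>(2) YZ)
  note contYZ = lipschitz_on_continuous_on[OF LY] lipschitz_on_continuous_on[OF LZ]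
  have rhsYZ: "continuous_on {0..T} (\<lambda>t. f (Y t) (Z t) t)" "continuous_on {0..T} (\<lambda>t. h (Y t) (Z t) t)"
    by - (rule continuous_on_along_curve[OF F(1) contYZ continuous_on_id approx], assumption,
        rule continuous_on_along_curve[OF F(2) contYZ continuous_on_id approx], assumption)
  \<comment> \<open>Off the nodes the interpolants are differentiable; the endpoints are excluded because \<open>z' = h\<close> is known in the interior.\<close>
  define S where "S = {0, T} \<union> (\<lambda>k. real k * \<Delta>) ` {..N}"
  have Y': "(Y has_vector_derivative vector_derivative Y (at t)) (at t)"
    "(Z has_vector_derivative vector_derivative Z (at t)) (at t)" if "t \<in> {0..T} - S" for t
    unfolding YZ using pw_linear_derivative_off_nodes[OF \<Delta>(1) assms(2)] that by (auto simp: S_def \<Delta>(2))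
  let ?ry = "\<lambda>t. f (Y t) (Z t) t - vector_derivative Y (at t)"
  let ?rz = "\<lambda>t. h (Y t) (Z t) t - vector_derivative Z (at t)"
  have total: "((\<lambda>t. \<nu>y t \<bullet> ?ry t + \<nu>z t \<bullet> ?rz t) has_integral
      (\<zeta>y \<bullet> (y T - Y T) + \<zeta>z \<bullet> (z T - Z T)) - (\<nu>y 0 \<bullet> (y 0 - Y 0) + \<nu>z 0 \<bullet> (z 0 - Z 0))) {0..T}"
  proof (rule adjoint_error_representation[OF assms(1) adj])
    show "absolutely_continuous_fun 0 T (\<lambda>t. y t - Y t)" "absolutely_continuous_fun 0 T (\<lambda>t. z t - Z t)"
      by (rule lipschitz_on_imp_absolutely_continuous_fun[OF lipschitz_on_diff[OF Ly LY]]
          lipschitz_on_imp_absolutely_continuous_fun[OF lipschitz_on_diff[OF Lz LZ]])+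
    show "negligible S"
      by (rule negligible_finite) (simp add: S_def)
    fix t assume t: "t \<in> {0..T} - S"
    then have t': "0 < t" "t < T" "t \<in> {0..T}"
      by (auto simp: S_def)
    have mean_f: "segment_average (jac_y f) y z Y Z t *v (y t - Y t)
        + segment_average (jac_z f) y z Y Z t *v (z t - Z t) = f (y t) (z t) t - f (Y t) (Z t) t"
      by (rule segment_average_mean_value[OF U f1, symmetric]) (rule seg[OF t'(3)])
    show "((\<lambda>t. y t - Y t) has_vector_derivative segment_average (jac_y f) y z Y Z t *v (y t - Y t)
        + segment_average (jac_z f) y z Y Z t *v (z t - Z t) + ?ry t) (at t)"
      unfolding mean_f using has_vector_derivative_diff[OF y'[OF t'(1,2)] Y'(1)[OF t]]
      by simp
    have mean_h: "segment_average (jac_y h) y z Y Z t *v (y t - Y t)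
        + segment_average (jac_z h) y z Y Z t *v (z t - Z t) = h (y t) (z t) t - h (Y t) (Z t) t"
      by (rule segment_average_mean_value[OF U h1, symmetric]) (rule seg[OF t'(3)])
    show "((\<lambda>t. z t - Z t) has_vector_derivative segment_average (jac_y h) y z Y Z t *v (y t - Y t)
        + segment_average (jac_z h) y z Y Z t *v (z t - Z t) + ?rz t) (at t)"
      unfolding mean_h using has_vector_derivative_diff[OF z'[OF t'(1,2)] Y'(2)[OF t]]
      by simp
  qed
  have \<nu>c: "continuous_on {0..T} \<nu>y" "continuous_on {0..T} \<nu>z"
    using adj absolutely_continuous_fun_imp_continuous_on unfolding adjoint_solution_def by blast+
  have smooth_part: "(\<lambda>t. \<nu>y t \<bullet> f (Y t) (Z t) t) integrable_on {0..T}"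
    "(\<lambda>t. \<nu>z t \<bullet> h (Y t) (Z t) t) integrable_on {0..T}"
    by (intro integrable_continuous_real continuous_on_inner \<nu>c rhsYZ)+
  have slope_part: "(\<lambda>t. \<nu>y t \<bullet> vector_derivative Y (at t)) integrable_on {0..T}"
    "(\<lambda>t. \<nu>z t \<bullet> vector_derivative Z (at t)) integrable_on {0..T}"
    using integrable_inner_pw_linear_derivative[OF \<Delta>(1), of N] \<nu>c unfolding YZ \<Delta>(2) by blast+
  have int: "(\<lambda>t. \<nu>y t \<bullet> ?ry t) integrable_on {0..T}" "(\<lambda>t. \<nu>z t \<bullet> ?rz t) integrable_on {0..T}"
    using integrable_diff[OF smooth_part(1) slope_part(1)] integrable_diff[OF smooth_part(2) slope_part(2)]
    by (simp_all only: inner_diff_right)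
  have "inner_int T \<nu>y ?ry + inner_int T \<nu>z ?rz
      = (\<zeta>y \<bullet> (y T - Y T) + \<zeta>z \<bullet> (z T - Z T)) - (\<nu>y 0 \<bullet> (y 0 - Y 0) + \<nu>z 0 \<bullet> (z 0 - Z 0))"
    unfolding inner_int_def integral_add[OF int, symmetric] by (rule integral_unique[OF total])
  then show ?thesis
    by (simp add: final_qoi_def inner_diff_left inner_commute[of _ \<zeta>y] inner_commute[of _ \<zeta>z] inner_diff_right)
qed

end
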